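(* Let $n\ge 2$, let $\Bbbk$ be an algebraically closed field of characteristic $0$, and let $P\Sigma_n$ be the basis-conjugating automorphism group of the free group $F_n=\langle x_1,\dots,x_n\rangle$, that is, the group of all automorphisms of $F_n$ which send each generator $x_i$ to a conjugate of itself. Let $\{e_{p,q}\mid 1\le p\neq q\le n\}$ be the basis of $H^1(P\Sigma_n;\Bbbk)$ dual to the basis $\{[\beta_{p,q}]\mid 1\le p\neq q\le n\}$ of $H_1(P\Sigma_n;\Bbbk)$, where $\beta_{p,q}\in P\Sigma_n$ is the automorphism with $\beta_{p,q}(x_p)=x_q^{-1}x_px_q$ and $\beta_{p,q}(x_k)=x_k$ for $k\ne p$. Then the first resonance variety of the cohomology ring $A=H^*(P\Sigma_n;\Bbbk)$ is \[ R^1(P\Sigma_n,\Bbbk)=\bigcup_{1\le i<j\le n}\operatorname{span}_{\Bbbk}\{e_{i,j},e_{j,i}\}\ \cup\ \bigcup_{1\le i<j<k\le n}\operatorname{span}_{\Bbbk}\{e_{j,i}-e_{k,i},\ e_{i,j}-e_{k,j},\ e_{i,k}-e_{j,k}\}. \]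
   Context: The group $P\Sigma_n$ is generated by the automorphisms $\beta_{i,j}$, $1\le i\ne j\le n$. By a theorem of McCool, it has a presentation with these generators and with relations $[\beta_{i,j},\beta_{k,l}]$, $[\beta_{i,k},\beta_{j,k}]$, $[\beta_{i,j},\beta_{i,k}\beta_{j,k}]$, where the indices in each relation are distinct and $[u,v]=uvu^{-1}v^{-1}$. Since all relations are commutators, $H_1(P\Sigma_n;\Bbbk)$ has dimension $n(n-1)$ with basis the classes $[\beta_{p,q}]$. By a theorem of Jensen, McCammond and Meier, the ring $H^*(P\Sigma_n;\mathbb{Z})$ is isomorphic to $E_{\mathbb{Z}}/I_{\mathbb{Z}}$, where $E_{\mathbb{Z}}$ is the exterior algebra over $\mathbb{Z}$ on degree-one generators $e_{p,q}$, $1\le p\ne q\le n$, and $I_{\mathbb{Z}}$ is the two-sided ideal generated by $e_{i,j}e_{j,i}$ for $1\le i<j\le n$ and $(e_{k,i}-e_{j,i})(e_{k,j}-e_{i,j})$ for $1\le k\le n$, $1\le i<j\le n$, $k\notin\{i,j\}$. The algebra $H^*(P\Sigma_n;\Bbbk)$ has the same presentation over $\Bbbk$. Resonance: let $A=\bigoplus_{k=0}^{\ell}A^k$ be a finite-dimensional, graded, connected algebra over $\Bbbk$ in which $a\cdot a=0$ for each $a\in A^1$ (such as the cohomology algebra above). For $a\in A^1$, left multiplication $\delta_a(x)=ax$ defines a cochain complex $(A,\delta_a)$: $A^0\to A^1\to A^2\to\cdots\to A^{\ell}$. The first resonance variety of $A$ is $R^1(A)=\{a\in A^1\mid H^1(A,\delta_a)\ne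 0\}$. The notation $R^1(P\Sigma_n,\Bbbk)$ means $R^1(H^*(P\Sigma_n;\Bbbk))$. *)

theory Defs
  imports
    "HOL-Computational_Algebra.Polynomial"
    "HOL-Algebra.Bij"
    "HOL-Algebra.AbelCoset"
    "HOL-Algebra.Module"
begin

section \<open>The free group on \<open>x\<^sub>1, \<dots>, x\<^sub>n\<close>\<close>

text \<open>
  The letter \<open>(i, True)\<close> stands for \<open>x\<^sub>i\<close> and \<open>(i, False)\<close> for its inverse. The elements of the
  free group are the reduced words, multiplied by concatenation followed by free reduction.
\<close>

type_synonym word = "(nat \<times> bool) list"

definition inv_letter :: "nat \<times> bool \<Rightarrow> nat \<times> bool" where
  "inv_letter x = (fst x, \<not> snd x)"

fun push :: "nat \<times> bool \<Rightarrow> word \<Rightarrow> word" where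
  "push x [] = [x]"
| "push x (y # ys) = (if y = inv_letter x then ys else x # y # ys)"

definition reduced_word :: "word \<Rightarrow> bool" where
  "reduced_word = successively (\<lambda>x y. y \<noteq> inv_letter x)"

definition free_group :: "nat \<Rightarrow> word monoid" where
  "free_group n =
     \<lparr>carrier = {w. reduced_word w \<and> fst ` set w \<subseteq> {1..n}},
      mult = (\<lambda>u v. foldr push u v),
      one = []\<rparr>"

definition gen :: "nat \<Rightarrow> word" where
  "gen i = [(i, True)]"

lemma inv_letter_inv_letter [simp]: "inv_letter (inv_letter x) = x"
  by (simp add: inv_letter_def)

lemma fst_inv_letter [simp]: "fst (inv_letter x) = fst x"
  by (simp add: inv_letter_def)

lemma inv_letter_neq [simp]: "inv_letter x \<noteq> x" "x \<noteq> inv_letter x"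
  by (cases x; simp add: inv_letter_def)+

lemma reduced_word_Nil [simp]: "reduced_word []"
  by (simp add: reduced_word_def)

lemma reduced_word_Cons:
  "reduced_word (x # w) \<longleftrightarrow> reduced_word w \<and> (w = [] \<or> hd w \<noteq> inv_letter x)"
  by (cases w) (auto simp: reduced_word_def)

lemma reduced_push: "reduced_word w \<Longrightarrow> reduced_word (push x w)"
  by (cases w) (auto simp: reduced_word_Cons)

lemma reduced_foldr_push: "reduced_word v \<Longrightarrow> reduced_word (foldr push u v)"
  by (induction u) (auto intro: reduced_push)

lemma set_push: "set (push x w) \<subseteq> insert x (set w)"
  by (cases w) auto

lemma set_foldr_push: "set (foldr push u v) \<subseteq> set u \<union> set v"
proof (induction u)
  case (Cons x u)
  then show ?case using set_push[of x "foldr push u v"] by auto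
qed simp

lemma push_push: "reduced_word w \<Longrightarrow> push x (push (inv_letter x) w) = w"
  by (cases w; cases "tl w") (auto simp: reduced_word_Cons)

lemma push_push': "reduced_word w \<Longrightarrow> push (inv_letter x) (push x w) = w"
  using push_push[of w "inv_letter x"] by simp

lemma foldr_push_push:
  assumes "reduced_word w"
  shows "foldr push (push x u) w = push x (foldr push u w)"
proof (cases u)
  case (Cons y ys)
  then show ?thesis
    using push_push[OF reduced_foldr_push[OF assms, of ys], of x] by simp
qed simp

lemma foldr_push_assoc:
  assumes "reduced_word w"
  shows "foldr push (foldr push u v) w = foldr push u (foldr push v w)"
  by (induction u) (simp_all add: foldr_push_push assms)

lemma foldr_push_Nil: "reduced_word u \<Longrightarrow> foldr push u [] = u"
proof (induction u)
  case (Cons x u)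
  then show ?case by (cases u) (auto simp: reduced_word_Cons)
qed simp

lemma foldr_push_inverse:
  assumes "reduced_word w"
  shows "foldr push (map inv_letter (rev u)) (foldr push u w) = w"
  using assms
  by (induction u arbitrary: w) (simp_all add: push_push' reduced_foldr_push)

lemma foldr_push_closed:
  assumes "reduced_word v" "fst ` set v \<subseteq> I" "fst ` set u \<subseteq> I"
  shows "reduced_word (foldr push u v)" "fst ` set (foldr push u v) \<subseteq> I"
proof -
  show "reduced_word (foldr push u v)"
    using assms(1) by (rule reduced_foldr_push)
  have "fst ` set (foldr push u v) \<subseteq> fst ` (set u \<union> set v)"
    using set_foldr_push by (rule image_mono)
  then show "fst ` set (foldr push u v) \<subseteq> I"
    using assms(2,3) unfolding image_Un by blast
qed

theorem group_free_group: "group (free_group n)"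
proof (rule groupI)
  fix u assume u: "u \<in> carrier (free_group n)"
  define v where "v = foldr push (map inv_letter (rev u)) []"
  have "v \<in> carrier (free_group n)"
    using u foldr_push_closed[of "[]" "{1..n}" "map inv_letter (rev u)"]
    by (auto simp: v_def free_group_def image_image)
  moreover have "foldr push v u = foldr push (map inv_letter (rev u)) (foldr push [] u)"
    using u by (simp add: v_def free_group_def foldr_push_assoc)
  then have "foldr push v u = foldr push (map inv_letter (rev u)) (foldr push u [])"
    using u by (simp add: free_group_def foldr_push_Nil)
  then have "foldr push v u = []"
    by (simp add: foldr_push_inverse)
  ultimately show "\<exists>v\<in>carrier (free_group n). v \<otimes>\<^bsub>free_group n\<^esub> u = \<one>\<^bsub>free_group n\<^esub>"
    by (auto simp: free_group_def)
next
  fix u v assume "u \<in> carrier (free_group n)" "v \<in> carrier (free_group n)"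
  then show "u \<otimes>\<^bsub>free_group n\<^esub> v \<in> carrier (free_group n)"
    using foldr_push_closed[of v "{1..n}" u] by (simp add: free_group_def)
qed (simp_all add: free_group_def foldr_push_assoc)


section \<open>The basis-conjugating automorphism group\<close>

text \<open>
  The product of \<^const>\<open>AutoGroup\<close> is composition of maps, \<open>(\<phi> \<psi>)(x) = \<phi> (\<psi> x)\<close>.
\<close>

definition P_Sigma :: "nat \<Rightarrow> (word \<Rightarrow> word) monoid" where
  "P_Sigma n = (AutoGroup (free_group n))
     \<lparr>carrier := {\<phi> \<in> auto (free_group n). \<forall>i\<in>{1..n}. \<exists>w\<in>carrier (free_group n).
        \<phi> (gen i) = inv\<^bsub>free_group n\<^esub> w \<otimes>\<^bsub>free_group n\<^esub> gen i \<otimes>\<^bsub>free_group n\<^esub> w}\<rparr>"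

definition beta :: "nat \<Rightarrow> nat \<Rightarrow> nat \<Rightarrow> word \<Rightarrow> word" where
  "beta n p q = (THE \<phi>. \<phi> \<in> carrier (P_Sigma n)
     \<and> \<phi> (gen p) = inv\<^bsub>free_group n\<^esub> (gen q) \<otimes>\<^bsub>free_group n\<^esub> gen p \<otimes>\<^bsub>free_group n\<^esub> gen q
     \<and> (\<forall>k\<in>{1..n}. k \<noteq> p \<longrightarrow> \<phi> (gen k) = gen k))"


section \<open>Vector spaces over a type-class field\<close>

definition scalar_ring :: "'k::field ring" where
  "scalar_ring = \<lparr>carrier = UNIV, mult = (*), one = 1, zero = 0, add = (+)\<rparr>"

definition lin_span :: "('k::field, 'v) module \<Rightarrow> 'v set \<Rightarrow> 'v set" where
  "lin_span M S = \<Inter> {H. submodule H scalar_ring M \<and> S \<subseteq> H}"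

text \<open>
  The type \<^type>\<open>module\<close> extends \<^type>\<open>ring\<close>; the fields \<^const>\<open>mult\<close> and \<^const>\<open>one\<close> play no role
  for modules.
\<close>

definition quotient_module :: "('k, 'v) module \<Rightarrow> 'v set \<Rightarrow> ('k, 'v set) module" where
  "quotient_module M B =
     \<lparr>carrier = a_rcosets\<^bsub>M\<^esub> B, mult = undefined, one = undefined,
      zero = B, add = (\<lambda>X Y. X <+>\<^bsub>M\<^esub> Y),
      smult = (\<lambda>c X. \<Union>x\<in>X. B +>\<^bsub>M\<^esub> (c \<odot>\<^bsub>M\<^esub> x))\<rparr>"


section \<open>Cohomology of a cochain complex\<close>

text \<open>A cochain complex \<open>(C, d)\<close> has \<open>d m : C m \<rightarrow> C (m + 1)\<close> for all \<open>m \<ge> 0\<close>.\<close>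

definition cocycles ::
  "(nat \<Rightarrow> ('k, 'v) module) \<Rightarrow> (nat \<Rightarrow> 'v \<Rightarrow> 'v) \<Rightarrow> nat \<Rightarrow> 'v set" where
  "cocycles C d m = {x \<in> carrier (C m). d m x = \<zero>\<^bsub>C (Suc m)\<^esub>}"

definition coboundaries ::
  "(nat \<Rightarrow> ('k, 'v) module) \<Rightarrow> (nat \<Rightarrow> 'v \<Rightarrow> 'v) \<Rightarrow> nat \<Rightarrow> 'v set" where
  "coboundaries C d m = (case m of 0 \<Rightarrow> {\<zero>\<^bsub>C 0\<^esub>} | Suc l \<Rightarrow> d l ` carrier (C l))"

definition cohomology ::
  "(nat \<Rightarrow> ('k, 'v) module) \<Rightarrow> (nat \<Rightarrow> 'v \<Rightarrow> 'v) \<Rightarrow> nat \<Rightarrow> ('k, 'v set) module" where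
  "cohomology C d m =
     quotient_module ((C m)\<lparr>carrier := cocycles C d m\<rparr>) (coboundaries C d m)"


section \<open>The first resonance variety of a graded algebra\<close>

text \<open>
  \<open>gmult A p q\<close> is the product \<open>A\<^sup>p \<times> A\<^sup>q \<rightarrow> A\<^sup>p\<^sup>+\<^sup>q\<close>.
\<close>

record ('k, 'v) graded_algebra =
  component :: "nat \<Rightarrow> ('k, 'v) module"
  gmult :: "nat \<Rightarrow> nat \<Rightarrow> 'v \<Rightarrow> 'v \<Rightarrow> 'v"

definition left_mult :: "('k, 'v) graded_algebra \<Rightarrow> 'v \<Rightarrow> nat \<Rightarrow> 'v \<Rightarrow> 'v" where
  "left_mult A a m x = gmult A 1 m a x"

definition first_resonance :: "('k, 'v) graded_algebra \<Rightarrow> 'v set" where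
  "first_resonance A = {a \<in> carrier (component A 1).
     carrier (cohomology (component A) (left_mult A a) 1)
       \<noteq> {\<zero>\<^bsub>cohomology (component A) (left_mult A a) 1\<^esub>}}"


section \<open>The cohomology ring of a group with trivial coefficients\<close>

text \<open>
  Inhomogeneous cochains: functions on \<open>G\<^sup>m\<close>, a tuple being a list of length \<open>m\<close>; they are
  extended by zero to all lists so that they add pointwise.
\<close>

definition tuples :: "('g, 'x) monoid_scheme \<Rightarrow> nat \<Rightarrow> 'g list set" where
  "tuples G m = {gs. length gs = m \<and> set gs \<subseteq> carrier G}"

definition cochains ::
  "('g, 'x) monoid_scheme \<Rightarrow> nat \<Rightarrow> ('k::field, 'g list \<Rightarrow> 'k) module" where
  "cochains G m =
     \<lparr>carrier = {f. \<forall>gs. gs \<notin> tuples G m \<longrightarrow> f gs = 0}, mult = undefined, one = undefined,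
      zero = (\<lambda>gs. 0), add = (\<lambda>f f' gs. f gs + f' gs), smult = (\<lambda>c f gs. c * f gs)\<rparr>"

definition coboundary ::
  "('g, 'x) monoid_scheme \<Rightarrow> nat \<Rightarrow> ('g list \<Rightarrow> 'k::field) \<Rightarrow> 'g list \<Rightarrow> 'k" where
  "coboundary G m f gs =
     (if gs \<in> tuples G (Suc m)
      then f (tl gs)
        + (\<Sum>i<m. (- 1) ^ Suc i
             * f (take i gs @ [gs ! i \<otimes>\<^bsub>G\<^esub> gs ! Suc i] @ drop (Suc (Suc i)) gs))
        + (- 1) ^ Suc m * f (butlast gs)
      else 0)"

definition cup ::
  "('g, 'x) monoid_scheme \<Rightarrow> nat \<Rightarrow> nat \<Rightarrow> ('g list \<Rightarrow> 'k::field) \<Rightarrow> ('g list \<Rightarrow> 'k)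
     \<Rightarrow> 'g list \<Rightarrow> 'k" where
  "cup G p q f f' gs =
     (if gs \<in> tuples G (p + q) then f (take p gs) * f' (drop p gs) else 0)"

definition group_cohomology ::
  "('g, 'x) monoid_scheme \<Rightarrow> nat \<Rightarrow> ('k::field, ('g list \<Rightarrow> 'k) set) module" where
  "group_cohomology G = cohomology (cochains G) (coboundary G)"

definition cohomology_ring ::
  "('g, 'x) monoid_scheme \<Rightarrow> ('k::field, ('g list \<Rightarrow> 'k) set) graded_algebra" where
  "cohomology_ring G =
     \<lparr>component = group_cohomology G,
      gmult = (\<lambda>p q X Y. \<Union>f\<in>X. \<Union>f'\<in>Y.
        coboundaries (cochains G) (coboundary G) (p + q) +>\<^bsub>cochains G (p + q)\<^esub> cup G p q f f')\<rparr>"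


section \<open>The dual basis of the first cohomology\<close>

text \<open>
  The class of \<open>g\<close> in the first homology group is represented by the one-tuple \<open>[g]\<close> of the bar
  complex, and its pairing with the cohomology class of a cocycle \<open>f\<close> is \<open>f [g]\<close>.
\<close>

definition dual_class ::
  "nat \<Rightarrow> nat \<Rightarrow> nat \<Rightarrow> ((word \<Rightarrow> word) list \<Rightarrow> 'k::field) set" where
  "dual_class n p q = (THE c. c \<in> carrier (group_cohomology (P_Sigma n) 1)
     \<and> (\<forall>f\<in>c. \<forall>r\<in>{1..n}. \<forall>s\<in>{1..n}. r \<noteq> s \<longrightarrow>
           f [beta n r s] = (if r = p \<and> s = q then 1 else 0)))"

end

(*
  Magnus coefficients give explicit functions on P_Sigma n. If phi(x_p) = w^-1 x_p w, then the
  coefficient of X_p X_q in phi(x_p) is the exponent sum of x_q in w, which is a homomorphism e_pq dual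
  to the generators; the coefficient of X_p X_j X_k (p, j distinct and j, k distinct) is up to a factor
  a second order coefficient of w, and its coboundary is the relation
  e_jk e_pj - e_kj e_pk + e_pj e_pk = 0, or e_jp e_pj = 0 if k = p. This shows that the spans on the
  right-hand side are isotropic for the cup product.

  Conversely, if the cup product of homomorphisms f and g is exact, then f(x) g(y) = f(y) g(x) whenever
  x and y commute. The pairs of commuting elements beta_ij, beta_kl; beta_ik, beta_jk;
  beta_ij, beta_ik beta_jk turn this into linear algebra for the vectors (f(beta_pq), g(beta_pq)).

  That a homomorphism is determined by its values on the beta_pq is proved by shortening the conjugators
  of an automorphism; if none of them absorbs another, then the automorphism is the identity.
*)

theory Submission
  imports Defs
begin

section \<open>Pairs of linear forms with vanishing minors\<close>

text \<open>A commuting pair x, y gives the 2-cycle [x|y] - [y|x] of a torus, and an exact product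
  vanishes on it. The second cohomology is therefore seen from two sides: tori give necessary
  conditions for a product to vanish, explicit primitives give sufficient ones, and the two meet on
  the spans of the theorem. The shape of the answer comes from the opposite pairs. No commutation
  relates beta_kl and beta_lk alone, so independent vectors can occur at such a pair. The linear
  algebra shows that they must occur at one, and that this pair forces all the other values. Since
  the coefficients are trivial, degree one has no nonzero coboundaries, and a class is the singleton
  of a homomorphism. Division by 2 occurs twice: to see that the square of a homomorphism is exact,
  and because X_p X_j X_p is found in w^-1 x_p w from both sides.\<close>

lemma eq_zero_if_parallel_to_independent:
  fixes x y :: "'k::field"
  assumes "x1 * y2 \<noteq> x2 * y1" "x1 * y = x * y1" "x2 * y = x * y2"
  shows "x = 0 \<and> y = 0"
proof -
  have "x * (x1 * y2 - x2 * y1) = x1 * (x * y2) - x2 * (x * y1)"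
    by (simp add: algebra_simps)
  also have "\<dots> = x1 * (x2 * y) - x2 * (x1 * y)"
    by (simp only: assms(2,3))
  finally have x: "x * (x1 * y2 - x2 * y1) = 0"
    by (simp add: algebra_simps)
  have "y * (x1 * y2 - x2 * y1) = (x1 * y) * y2 - (x2 * y) * y1"
    by (simp add: algebra_simps)
  also have "\<dots> = (x * y1) * y2 - (x * y2) * y1"
    by (simp only: assms(2,3))
  finally have "y * (x1 * y2 - x2 * y1) = 0"
    by (simp add: algebra_simps)
  with x show ?thesis
    using assms(1) by simp
qed

lemma parallel_trans:
  fixes x y :: "'k::field"
  assumes "x \<noteq> 0 \<or> y \<noteq> 0" "x1 * y = x * y1" "x2 * y = x * y2"
  shows "x1 * y2 = x2 * y1"
  using eq_zero_if_parallel_to_independent assms by blast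

text \<open>Write v_pq for the plane vector \<open>(a p q, b p q)\<close>. Independence of any two
  vectors is moved to an opposite pair v_kl, v_lk. This pair is then a basis of the plane: whatever
  is parallel to both vanishes, and for a further index p only the two shapes in \<open>near\<close>
  remain. At most one index m has the nonzero shape, which gives the two alternatives.\<close>

lemma coefficients_of_isotropic_pair:
  fixes a b :: "'i \<Rightarrow> 'i \<Rightarrow> 'k::field"
  assumes disjoint: "\<And>i j k l. \<lbrakk>i \<in> I; j \<in> I; k \<in> I; l \<in> I; distinct [i, j, k, l]\<rbrakk>
      \<Longrightarrow> a i j * b k l = a k l * b i j"
    and target: "\<And>i j k. \<lbrakk>i \<in> I; j \<in> I; k \<in> I; distinct [i, j, k]\<rbrakk>
      \<Longrightarrow> a i k * b j k = a j k * b i k"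
    and triple: "\<And>i j k. \<lbrakk>i \<in> I; j \<in> I; k \<in> I; distinct [i, j, k]\<rbrakk>
      \<Longrightarrow> a i j * (b i k + b j k) = (a i k + a j k) * b i j"
    and indep: "i0 \<in> I" "j0 \<in> I" "k0 \<in> I" "l0 \<in> I" "i0 \<noteq> j0" "k0 \<noteq> l0"
      "a i0 j0 * b k0 l0 \<noteq> a k0 l0 * b i0 j0"
  obtains (two) k l where "k \<in> I" "l \<in> I" "k \<noteq> l"
      "\<And>p q. \<lbrakk>p \<in> I; q \<in> I; p \<noteq> q; {p, q} \<noteq> {k, l}\<rbrakk> \<Longrightarrow> a p q = 0"
    | (three) k l m where "k \<in> I" "l \<in> I" "m \<in> I" "distinct [k, l, m]"
      "a l k = - a m k" "a k l = - a m l" "a k m = - a l m"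
      "\<And>p q. \<lbrakk>p \<in> I; q \<in> I; p \<noteq> q; \<not> {p, q} \<subseteq> {k, l, m}\<rbrakk> \<Longrightarrow> a p q = 0"
proof -
  \<comment> \<open>As v_ij is parallel to v_ik + v_jk, it is independent of v_jk; likewise v_ik is
    independent of v_kj. If v_jk and v_kj were parallel, then v_ik, being parallel to the nonzero
    v_jk, would be parallel to v_kj.\<close>
  have source: "\<exists>k\<in>I. \<exists>l\<in>I. k \<noteq> l \<and> a k l * b l k \<noteq> a l k * b k l"
    if I: "i \<in> I" "j \<in> I" "k \<in> I" and d: "distinct [i, j, k]"
      and ne: "a i j * b i k \<noteq> a i k * b i j" for i j k
  proof (rule ccontr)
    assume "\<not> ?thesis"
    then have op: "a j k * b k j = a k j * b j k"
      using I d by auto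
    have 1: "a i j * b j k \<noteq> a j k * b i j"
      using triple[of i j k] I d ne by (auto simp: algebra_simps)
    have 2: "a i k * b k j \<noteq> a k j * b i k"
      using triple[of i k j] I d ne by (auto simp: algebra_simps)
    have 3: "a i j * b k j = a k j * b i j"
      using target[of i k j] I d by auto
    have 4: "a i k * b j k = a j k * b i k"
      using target[of i j k] I d by auto
    have "a j k \<noteq> 0 \<or> b j k \<noteq> 0" using 1 by auto
    then have "a i k * b k j = a k j * b i k"
      using parallel_trans[of "a j k" "b j k" "a i k" "b i k" "a k j" "b k j"] 4 op by auto
    then show False using 2 by simp
  qed
  \<comment> \<open>v_ij is parallel to v_ik + v_jk, so its independence of v_jk is also
    independence of v_ik.\<close>
  have chain: "\<exists>k\<in>I. \<exists>l\<in>I. k \<noteq> l \<and> a k l * b l k \<noteq> a l k * b k l"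
    if I: "i \<in> I" "j \<in> I" "k \<in> I" and d: "distinct [i, j, k]"
      and ne: "a i j * b j k \<noteq> a j k * b i j" for i j k
  proof -
    have "a i j * b i k \<noteq> a i k * b i j"
      using triple[of i j k] I d ne by (auto simp: algebra_simps)
    then show ?thesis using source[OF I d] by blast
  qed
  have "\<exists>k\<in>I. \<exists>l\<in>I. k \<noteq> l \<and> a k l * b l k \<noteq> a l k * b k l"
  proof -
    consider "i0 = k0" "j0 = l0" | "i0 = k0" "j0 \<noteq> l0" | "i0 \<noteq> k0" "j0 = l0"
      | "i0 = l0" "j0 = k0" | "i0 = l0" "j0 \<noteq> k0" | "i0 \<noteq> l0" "j0 = k0"
      | "distinct [i0, j0, k0, l0]"
      using indep by auto
    then show ?thesis
    proof cases
      case 1 then show ?thesis using indep by auto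
    next
      case 2 then show ?thesis using source[of i0 j0 l0] indep by auto
    next
      case 3 then show ?thesis using target[of i0 k0 j0] indep by auto
    next
      case 4 then show ?thesis using indep by metis
    next
      case 5 then show ?thesis using chain[of k0 l0 j0] indep by auto
    next
      case 6 then show ?thesis using chain[of i0 j0 l0] indep by auto
    next
      case 7 then show ?thesis using disjoint[of i0 j0 k0 l0] indep by auto
    qed
  qed
  then obtain k l where k: "k \<in> I" "l \<in> I" "k \<noteq> l" and kl: "a k l * b l k \<noteq> a l k * b k l"
    by blast
  have zero: "x = 0 \<and> y = 0" if "a k l * y = x * b k l" "a l k * y = x * b l k" for x y
    using eq_zero_if_parallel_to_independent[OF kl that] .
  have far: "a p q = 0" if "p \<in> I" "q \<in> I" "p \<noteq> q" "{p, q} \<inter> {k, l} = {}" for p q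
    using zero[of "b p q" "a p q"] disjoint[of k l p q] disjoint[of l k p q] that k by auto
  \<comment> \<open>By \<open>triple\<close>, v_kp + v_lp is parallel to v_kl and, with k and l
    exchanged, to v_lk.\<close>
  have sum0: "a k p + a l p = 0 \<and> b k p + b l p = 0" if "p \<in> I" "p \<noteq> k" "p \<noteq> l" for p
    by (rule zero) (use triple[of k l p] triple[of l k p] that k in \<open>auto simp: add.commute\<close>)
  have near: "(a p k = 0 \<and> a p l = 0 \<and> a k p = 0 \<and> a l p = 0)
      \<or> (a p k = - a l k \<and> a p l = - a k l \<and> b p k = - b l k \<and> b p l = - b k l)"
    if p: "p \<in> I" "p \<noteq> k" "p \<noteq> l" for p
  proof -
    let ?D = "a k l * b l k - a l k * b k l"
    have D: "?D \<noteq> 0" using kl by simp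
    have t1: "a p l * b k l = a k l * b p l" using target[of p k l] p k by auto
    have t2: "a p k * b l k = a l k * b p k" using target[of p l k] p k by auto
    have nz: "a k l \<noteq> 0 \<or> b k l \<noteq> 0" "a l k \<noteq> 0 \<or> b l k \<noteq> 0" using kl by auto
    \<comment> \<open>By \<open>target\<close>, v_pl = s v_kl and v_pk = t v_lk. The vectors v_kl
      and v_lk are nonzero, but either coordinate may vanish, hence the case distinctions.\<close>
    obtain s where s: "a p l = s * a k l" "b p l = s * b k l"
    proof (cases "a k l = 0")
      case True
      then show ?thesis using that[of "b p l / b k l"] t1 nz by (auto simp: field_simps)
    next
      case False
      then show ?thesis using that[of "a p l / a k l"] t1 by (auto simp: field_simps)
    qed
    obtain t where t: "a p k = t * a l k" "b p k = t * b l k"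
    proof (cases "a l k = 0")
      case True
      then show ?thesis using that[of "b p k / b l k"] t2 nz by (auto simp: field_simps)
    next
      case False
      then show ?thesis using that[of "a p k / a l k"] t2 by (auto simp: field_simps)
    qed
    \<comment> \<open>Now v_pk = t v_lk is parallel to v_pl + v_kl = (1 + s) v_kl. Since
      \<open>?D\<close> is the determinant of v_kl and v_lk, this means t (1 + s) = 0. By symmetry s
      (1 + t) = 0, so s = t is 0 or -1.\<close>
    have "a p k * (b p l + b k l) = (a p l + a k l) * b p k"
      using triple[of p k l] p k by auto
    then have "t * (1 + s) * ?D = 0" unfolding s t by (simp add: algebra_simps)
    then have e1: "t * (1 + s) = 0" using D by simp
    have "a p l * (b p k + b l k) = (a p k + a l k) * b p l"
      using triple[of p l k] p k by auto
    then have "s * (1 + t) * ?D = 0" unfolding s t by (simp add: algebra_simps)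
    then have e2: "s * (1 + t) = 0" using D by simp
    have "t + s * t = s + s * t" using e1 e2 by (simp add: algebra_simps)
    then have "s = t" by simp
    then have "t = 0 \<or> t = -1" using e1 by (simp add: eq_neg_iff_add_eq_0 add.commute)
    then show ?thesis
    proof
      assume "t = 0"
      then have z: "a p k = 0" "a p l = 0" "b p k = 0" "b p l = 0" using s t \<open>s = t\<close> by auto
      \<comment> \<open>With v_pk = v_pl = 0, \<open>triple\<close> makes v_kp parallel to v_kl and
        v_lp parallel to v_lk. As v_lp = - v_kp, both are zero.\<close>
      have 1: "a k p * b k l = a k l * b k p"
        using triple[of k p l] p k z by auto
      have 2: "a l p * b l k = a l k * b l p"
        using triple[of l p k] p k z by auto
      have "a l p = - a k p" "b l p = - b k p"
        using sum0[OF p] by (simp_all add: eq_neg_iff_add_eq_0 add.commute)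
      then show ?thesis
        using zero[of "b k p" "a k p"] 1 2 z by auto
    qed (use s t \<open>s = t\<close> in simp)
  qed
  show thesis
  proof (cases "\<exists>p\<in>I. p \<noteq> k \<and> p \<noteq> l \<and> \<not> (a p k = 0 \<and> a p l = 0 \<and> a k p = 0 \<and> a l p = 0)")
    case False
    have "a p q = 0" if "p \<in> I" "q \<in> I" "p \<noteq> q" "{p, q} \<noteq> {k, l}" for p q
    proof (cases "{p, q} \<inter> {k, l} = {}")
      case True then show ?thesis using far that by auto
    next
      case *: False
      then show ?thesis using False that by auto
    qed
    then show thesis using two[of k l] k by blast
  next
    case True
    then obtain m where m: "m \<in> I" "m \<noteq> k" "m \<noteq> l"
      and nm: "a m k = - a l k" "a m l = - a k l" "b m k = - b l k" "b m l = - b k l"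
      using near by blast
    \<comment> \<open>A second index q of the nonzero shape would give v_qk = - v_lk, while v_ml = -
      v_kl. The index pairs (q, k) and (m, l) are disjoint, so v_kl and v_lk would be
      parallel.\<close>
    have other: "a q k = 0 \<and> a q l = 0 \<and> a k q = 0 \<and> a l q = 0"
      if q: "q \<in> I" "q \<noteq> k" "q \<noteq> l" "q \<noteq> m" for q
    proof (rule ccontr)
      assume "\<not> ?thesis"
      then have "a q k = - a l k" "b q k = - b l k" using near q by auto
      moreover have "a m l * b q k = a q k * b m l" using disjoint[of m l q k] q m k by auto
      ultimately show False using kl nm by (simp add: mult.commute)
    qed
    have "a p q = 0" if pq: "p \<in> I" "q \<in> I" "p \<noteq> q" "\<not> {p, q} \<subseteq> {k, l, m}" for p q
    proof (cases "{p, q} \<inter> {k, l} = {}")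
      case True then show ?thesis using far pq by auto
    next
      case False
      then show ?thesis using other pq by auto
    qed
    moreover have "a k m = - a l m"
      using sum0[of m] m by (simp add: eq_neg_iff_add_eq_0)
    ultimately show thesis using three[of k l m] k m nm by auto
  qed
qed

section \<open>Magnus coefficients of words\<close>

definition word_inv :: "word \<Rightarrow> word" where
  "word_inv w = map inv_letter (rev w)"

definition letter_sign :: "nat \<times> bool \<Rightarrow> 'k::comm_ring_1" where
  "letter_sign x = (if snd x then 1 else - 1)"

text \<open>
  For a sequence \<open>i\<^sub>1, \<dots>, i\<^sub>m\<close> without equal neighbours, \<open>magnus [i\<^sub>1, \<dots>, i\<^sub>m] w\<close> is the
  coefficient of \<open>X\<^bsub>i\<^sub>1\<^esub> \<cdots> X\<^bsub>i\<^sub>m\<^esub>\<close> in the image of \<open>w\<close> under the Magnus expansion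
  \<open>x\<^sub>i \<mapsto> 1 + X\<^sub>i\<close>. The powers \<open>X\<^sub>i\<^sup>2, X\<^sub>i\<^sup>3, \<dots>\<close> in the image of the inverse of \<open>x\<^sub>i\<close> do not
  contribute to such coefficients, and the recursion ignores them.
\<close>

fun magnus :: "nat list \<Rightarrow> word \<Rightarrow> 'k::comm_ring_1" where
  "magnus [] w = 1"
| "magnus (i # s) [] = 0"
| "magnus (i # s) (x # w) = magnus (i # s) w + (if fst x = i then letter_sign x * magnus s w else 0)"

lemma letter_sign_inv_letter [simp]: "letter_sign (inv_letter x) = - letter_sign x"
  by (simp add: letter_sign_def inv_letter_def)

lemma letter_sign_True [simp]: "letter_sign (i, True) = 1"
  by (simp add: letter_sign_def)

text \<open>A letter and its inverse contribute opposite terms when only one of them is used; using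
  both takes two equal neighbours in \<open>s\<close>. For such \<open>s\<close> the coefficient is
  thus invariant under free cancellation, although the recursion drops the higher powers.\<close>

lemma magnus_push: "distinct_adj s \<Longrightarrow> magnus s (push x w) = magnus s (x # w)"
proof (cases "\<exists>v. w = inv_letter x # v")
  case True
  assume "distinct_adj s"
  obtain v where "w = inv_letter x # v" using True by blast
  with \<open>distinct_adj s\<close> show ?thesis
    by (cases s; cases "tl s") auto
next
  case False
  then show ?thesis by (cases w) auto
qed

lemma magnus_foldr_push:
  "distinct_adj s \<Longrightarrow> (magnus s (foldr push u v) :: 'k::comm_ring_1) = magnus s (u @ v)"
proof (induction u arbitrary: s)
  case (Cons x u)
  then have "(magnus s (foldr push (x # u) v) :: 'k) = magnus s (x # foldr push u v)"
    using magnus_push by simp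
  also have "\<dots> = magnus s (x # u @ v)"
    using Cons by (cases s) (auto dest: distinct_adj_ConsD)
  finally show ?case by simp
qed simp

lemma magnus_append1: "magnus [i] (u @ v) = magnus [i] u + magnus [i] v"
  by (induction u) auto

lemma magnus_append2:
  "magnus [i, j] (u @ v) = magnus [i, j] u + magnus [i] u * magnus [j] v + magnus [i, j] v"
  by (induction u) (auto simp: magnus_append1 algebra_simps)

lemma magnus_append3:
  "magnus [i, j, k] (u @ v) = magnus [i, j, k] u + magnus [i, j] u * magnus [k] v
    + magnus [i] u * magnus [j, k] v + magnus [i, j, k] v"
  by (induction u) (auto simp: magnus_append2 algebra_simps)

text \<open>Both sides count, with signs, the pairs of a letter x_i and a letter x_j in
  \<open>w\<close>, in either order; i \<noteq> j excludes that one letter is used for both.\<close>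

lemma magnus_shuffle: "i \<noteq> j \<Longrightarrow> magnus [i, j] w + magnus [j, i] w = magnus [i] w * magnus [j] w"
proof (induction w)
  case (Cons x w)
  then show ?case
    by (auto simp: algebra_simps)
qed simp

lemma magnus_word_inv_append:
  assumes "distinct_adj s"
  shows "magnus s (word_inv w @ w) = magnus s []"
proof -
  have "foldr push (word_inv w @ w) [] = []"
    using foldr_push_inverse[of "[]" w] by (simp add: word_inv_def)
  then show ?thesis
    using magnus_foldr_push[OF assms] by (metis append_Nil2)
qed

lemma magnus_word_inv1: "(magnus [i] (word_inv w) :: 'k::comm_ring_1) = - magnus [i] w"
  using magnus_word_inv_append[of "[i]" w, where 'a = 'k] by (simp add: magnus_append1 eq_neg_iff_add_eq_0)

lemma magnus_word_inv2:
  assumes "i \<noteq> j"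
  shows "(magnus [i, j] (word_inv w) :: 'k::comm_ring_1) = magnus [j, i] w"
proof -
  have "(magnus [i, j] (word_inv w) :: 'k) = magnus [i] w * magnus [j] w - magnus [i, j] w"
    using magnus_word_inv_append[of "[i, j]" w, where 'a = 'k] assms
    by (simp add: magnus_append2 magnus_word_inv1 algebra_simps eq_neg_iff_add_eq_0)
  then show ?thesis
    using magnus_shuffle[OF assms, of w, where 'a = 'k] by (metis add_diff_cancel_left')
qed

text \<open>The reduced word of w^-1 x_p w, written without \<open>free_group n\<close> so that it
  does not depend on the rank.\<close>

definition conj_word :: "nat \<Rightarrow> word \<Rightarrow> word" where
  "conj_word p w = foldr push (word_inv w) (foldr push (gen p) w)"

lemma magnus_conj_word:
  assumes s: "distinct_adj s"
  shows "(magnus s (conj_word p w) :: 'k::comm_ring_1) = magnus s (word_inv w @ (p, True) # w)"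
proof -
  have "(magnus s (conj_word p w) :: 'k) = magnus s (word_inv w @ push (p, True) w)"
    using s by (simp add: conj_word_def magnus_foldr_push gen_def)
  also have "\<dots> = magnus s (foldr push (word_inv w @ [(p, True)]) w)"
    using s by (simp add: magnus_foldr_push)
  also have "\<dots> = magnus s (word_inv w @ (p, True) # w)"
    using s magnus_foldr_push[of s "word_inv w @ [(p, True)]" w] by simp
  finally show ?thesis .
qed

lemma magnus_conj_word1: "magnus [i] (conj_word p w) = (if i = p then 1 else 0)"
  by (simp add: magnus_conj_word magnus_append1 magnus_word_inv1)

lemma magnus_conj_word2:
  assumes "j \<noteq> k"
  shows "(magnus [j, k] (conj_word p w) :: 'k::comm_ring_1)
    = (if p = j then magnus [k] w else 0) - (if p = k then magnus [j] w else 0)"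
  using assms magnus_shuffle[OF assms, of w, where 'a = 'k]
  by (auto simp: magnus_conj_word magnus_append2 magnus_word_inv1 magnus_word_inv2 algebra_simps)

text \<open>In w^-1 x_p w the middle letter can supply X_p in the first place, leaving X_j X_k to
  \<open>w\<close>. If k = p, it can also supply the last X_p, leaving X_p X_j to the inverse of
  \<open>w\<close>, where its coefficient is that of X_j X_p in \<open>w\<close>. Hence the factor
  2.\<close>

lemma magnus_conj_word3:
  assumes "p \<noteq> j" "j \<noteq> k"
  shows "(magnus [p, j, k] (conj_word p w) :: 'k::comm_ring_1)
    = (if k = p then 2 else 1) * magnus [j, k] w"
proof -
  have "(magnus [p, j, k] (word_inv w @ w) :: 'k) = 0"
    using assms by (simp add: magnus_word_inv_append)
  then have "(magnus [p, j, k] (word_inv w) :: 'k) + magnus [p, j] (word_inv w) * magnus [k] w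
      + magnus [p] (word_inv w) * magnus [j, k] w + magnus [p, j, k] w = 0"
    by (simp add: magnus_append3)
  then have "(magnus [p, j, k] (conj_word p w) :: 'k)
      = magnus [p, j] (word_inv w) * (if k = p then 1 else 0) + magnus [j, k] w"
    using assms by (cases "k = p") (simp_all add: magnus_conj_word magnus_append3 algebra_simps)
  then show ?thesis
    using assms by (auto simp: magnus_word_inv2)
qed

section \<open>Endomorphisms of the free group\<close>

lemma carrier_free_group:
  "w \<in> carrier (free_group n) \<longleftrightarrow> reduced_word w \<and> fst ` set w \<subseteq> {1..n}"
  by (simp add: free_group_def)

lemma mult_free_group [simp]: "u \<otimes>\<^bsub>free_group n\<^esub> v = foldr push u v"
  by (simp add: free_group_def)

lemma one_free_group [simp]: "\<one>\<^bsub>free_group n\<^esub> = []"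
  by (simp add: free_group_def)

lemma reduced_word_append:
  "reduced_word (u @ v) \<longleftrightarrow> reduced_word u \<and> reduced_word v
    \<and> (u = [] \<or> v = [] \<or> hd v \<noteq> inv_letter (last u))"
  by (auto simp: reduced_word_def successively_append_iff)

lemma reduced_word_word_inv: "reduced_word w \<Longrightarrow> reduced_word (word_inv w)"
  unfolding reduced_word_def word_inv_def successively_map successively_rev
  by (auto elim!: successively_mono)

lemma word_inv_closed: "w \<in> carrier (free_group n) \<Longrightarrow> word_inv w \<in> carrier (free_group n)"
  by (simp add: carrier_free_group reduced_word_word_inv) (simp add: word_inv_def image_image)

lemma word_inv_word_inv [simp]: "word_inv (word_inv w) = w"
  by (simp add: word_inv_def rev_map comp_def)

lemma mult_closed_free_group:
  "\<lbrakk>u \<in> carrier (free_group n); v \<in> carrier (free_group n)\<rbrakk>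
    \<Longrightarrow> foldr push u v \<in> carrier (free_group n)"
  using group.is_monoid[OF group_free_group, THEN monoid.m_closed, of u n v] by simp

lemma inv_free_group:
  assumes "w \<in> carrier (free_group n)"
  shows "inv\<^bsub>free_group n\<^esub> w = word_inv w"
proof (rule group.inv_equality[OF group_free_group])
  have "foldr push (word_inv w) (foldr push w []) = []"
    using foldr_push_inverse[of "[]" w] by (simp add: word_inv_def)
  then show "word_inv w \<otimes>\<^bsub>free_group n\<^esub> w = \<one>\<^bsub>free_group n\<^esub>"
    using assms by (simp add: carrier_free_group foldr_push_Nil)
qed (use assms word_inv_closed in auto)

lemma gen_closed: "i \<in> {1..n} \<Longrightarrow> gen i \<in> carrier (free_group n)"
  by (simp add: carrier_free_group gen_def reduced_word_def)

lemma letter_closed: "fst x \<in> {1..n} \<Longrightarrow> [x] \<in> carrier (free_group n)"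
  by (simp add: carrier_free_group reduced_word_def)

lemma conj_word_closed:
  "\<lbrakk>w \<in> carrier (free_group n); p \<in> {1..n}\<rbrakk> \<Longrightarrow> conj_word p w \<in> carrier (free_group n)"
  unfolding conj_word_def by (intro mult_closed_free_group word_inv_closed gen_closed)

lemma conj_word_eq_conj:
  assumes "w \<in> carrier (free_group n)" "p \<in> {1..n}"
  shows "inv\<^bsub>free_group n\<^esub> w \<otimes>\<^bsub>free_group n\<^esub> gen p \<otimes>\<^bsub>free_group n\<^esub> w = conj_word p w"
  using assms by (simp add: inv_free_group conj_word_def foldr_push_assoc carrier_free_group)

lemma conj_word_Nil [simp]: "conj_word p [] = gen p"
  by (simp add: conj_word_def word_inv_def gen_def)

lemma hom_free_group_closed:
  "\<lbrakk>\<phi> \<in> hom (free_group n) (free_group n); w \<in> carrier (free_group n)\<rbrakk>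
    \<Longrightarrow> \<phi> w \<in> carrier (free_group n)"
  by (rule hom_in_carrier)

lemma hom_free_group_mult:
  assumes "\<phi> \<in> hom (free_group n) (free_group n)"
    "u \<in> carrier (free_group n)" "v \<in> carrier (free_group n)"
  shows "\<phi> (foldr push u v) = foldr push (\<phi> u) (\<phi> v)"
  using hom_mult[OF assms] by simp

lemma hom_free_group_Nil: "\<phi> \<in> hom (free_group n) (free_group n) \<Longrightarrow> \<phi> [] = []"
  using hom_one[OF _ group_free_group group_free_group, of \<phi> n n] by simp

lemma hom_free_group_word_inv:
  assumes "\<phi> \<in> hom (free_group n) (free_group n)" "w \<in> carrier (free_group n)"
  shows "\<phi> (word_inv w) = word_inv (\<phi> w)"
proof -
  interpret group_hom "free_group n" "free_group n" \<phi>
    using assms group_free_group by (simp add: group_hom_def group_hom_axioms_def)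
  show ?thesis using hom_inv[of w] assms by (simp add: inv_free_group)
qed

lemma hom_free_group_Cons:
  assumes "\<phi> \<in> hom (free_group n) (free_group n)" "x # w \<in> carrier (free_group n)"
  shows "\<phi> (x # w) = foldr push (\<phi> [x]) (\<phi> w)"
proof -
  have "[x] \<in> carrier (free_group n)" "w \<in> carrier (free_group n)"
    using assms by (auto simp: carrier_free_group reduced_word_Cons)
  moreover have "foldr push [x] w = x # w"
    using assms by (cases w) (auto simp: carrier_free_group reduced_word_Cons)
  ultimately show ?thesis using hom_free_group_mult[OF assms(1)] by metis
qed

lemma hom_free_group_letter:
  assumes "\<phi> \<in> hom (free_group n) (free_group n)" "fst x \<in> {1..n}"
  shows "\<phi> [x] = (if snd x then \<phi> (gen (fst x)) else word_inv (\<phi> (gen (fst x))))"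
proof -
  have "[x] = (if snd x then gen (fst x) else word_inv (gen (fst x)))"
    by (cases x) (auto simp: gen_def word_inv_def inv_letter_def)
  then show ?thesis
    using hom_free_group_word_inv[OF assms(1) gen_closed[OF assms(2)]] by auto
qed

lemma hom_free_group_eqI:
  assumes "\<phi> \<in> hom (free_group n) (free_group n)" "\<psi> \<in> hom (free_group n) (free_group n)"
    and "\<And>i. i \<in> {1..n} \<Longrightarrow> \<phi> (gen i) = \<psi> (gen i)"
    and "w \<in> carrier (free_group n)"
  shows "\<phi> w = \<psi> w"
  using assms(4)
proof (induction w)
  case Nil
  then show ?case using assms(1,2) by (simp add: hom_free_group_Nil)
next
  case (Cons x w)
  then have "w \<in> carrier (free_group n)" "fst x \<in> {1..n}"
    by (auto simp: carrier_free_group reduced_word_Cons)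
  then show ?case
    using Cons assms(1-3) by (simp add: hom_free_group_Cons hom_free_group_letter)
qed

text \<open>Conjugators compose by the twisted rule u \<phi>(w). Every later computation with
  products of automorphisms starts from it.\<close>

lemma hom_free_group_conj_word:
  assumes \<phi>: "\<phi> \<in> hom (free_group n) (free_group n)"
    and w: "w \<in> carrier (free_group n)" and i: "i \<in> {1..n}"
    and u: "u \<in> carrier (free_group n)" "\<phi> (gen i) = conj_word i u"
  shows "\<phi> (conj_word i w) = conj_word i (foldr push u (\<phi> w))"
proof -
  interpret F: group "free_group n" by (rule group_free_group)
  interpret group_hom "free_group n" "free_group n" \<phi>
    using \<phi> by (simp add: group_hom_def group_hom_axioms_def group_free_group)
  let ?\<phi>w = "\<phi> w"
  have c: "?\<phi>w \<in> carrier (free_group n)" "gen i \<in> carrier (free_group n)"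
    using w i \<phi> by (auto simp: gen_closed hom_free_group_closed)
  have "\<phi> (conj_word i w)
      = inv\<^bsub>free_group n\<^esub> ?\<phi>w \<otimes>\<^bsub>free_group n\<^esub>
        (inv\<^bsub>free_group n\<^esub> u \<otimes>\<^bsub>free_group n\<^esub> gen i \<otimes>\<^bsub>free_group n\<^esub> u) \<otimes>\<^bsub>free_group n\<^esub> ?\<phi>w"
    using w i u c
    by (simp add: conj_word_eq_conj[symmetric] F.inv_closed del: mult_free_group one_free_group)
  also have "\<dots> = inv\<^bsub>free_group n\<^esub> (u \<otimes>\<^bsub>free_group n\<^esub> ?\<phi>w) \<otimes>\<^bsub>free_group n\<^esub> gen i
      \<otimes>\<^bsub>free_group n\<^esub> (u \<otimes>\<^bsub>free_group n\<^esub> ?\<phi>w)"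
    using c u by (simp add: F.m_assoc F.inv_mult_group del: mult_free_group one_free_group)
  also have "\<dots> = conj_word i (u \<otimes>\<^bsub>free_group n\<^esub> ?\<phi>w)"
    using c u i by (intro conj_word_eq_conj) (auto simp del: mult_free_group)
  finally show ?thesis by simp
qed

section \<open>The universal property of the free group\<close>

definition letter_image :: "(nat \<Rightarrow> word) \<Rightarrow> nat \<times> bool \<Rightarrow> word" where
  "letter_image u x = (if snd x then u (fst x) else word_inv (u (fst x)))"

text \<open>The restriction to the carrier makes the map extensional, as the elements of
  \<open>AutoGroup\<close> have to be.\<close>

definition extend_hom :: "nat \<Rightarrow> (nat \<Rightarrow> word) \<Rightarrow> word \<Rightarrow> word" where
  "extend_hom n u = (\<lambda>w\<in>carrier (free_group n). foldr (\<lambda>x. foldr push (letter_image u x)) w [])"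

lemma extend_hom_gen:
  assumes "i \<in> {1..n}" "u i \<in> carrier (free_group n)"
  shows "extend_hom n u (gen i) = u i"
  using gen_closed[OF assms(1)] assms(2)
  by (simp add: extend_hom_def gen_def letter_image_def foldr_push_Nil carrier_free_group)

text \<open>Letterwise evaluation respects concatenation; only a cancellation in \<open>push\<close>
  could spoil multiplicativity, and there the images of a letter and its inverse cancel as
  well.\<close>

lemma extend_hom_hom:
  assumes u: "\<And>i. i \<in> {1..n} \<Longrightarrow> u i \<in> carrier (free_group n)"
  shows "extend_hom n u \<in> hom (free_group n) (free_group n)"
proof -
  let ?E = "\<lambda>w. foldr (\<lambda>x. foldr push (letter_image u x)) w []"
  have img: "letter_image u x \<in> carrier (free_group n)" if "fst x \<in> {1..n}" for x
    using u[OF that] word_inv_closed by (auto simp: letter_image_def)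
  have closed: "?E w \<in> carrier (free_group n)" if "fst ` set w \<subseteq> {1..n}" for w
    using that
  proof (induction w)
    case Nil then show ?case by (simp add: carrier_free_group)
  next
    case (Cons x w)
    then show ?case using mult_closed_free_group[OF img] by auto
  qed
  have cancel: "foldr push (letter_image u x) (foldr push (letter_image u (inv_letter x)) w) = w"
    if "reduced_word w" for x w
    using foldr_push_inverse[OF that, of "u (fst x)"]
      foldr_push_inverse[OF that, of "word_inv (u (fst x))"]
    by (cases x) (auto simp: letter_image_def inv_letter_def word_inv_def[symmetric])
  have push: "?E (push x w) = foldr push (letter_image u x) (?E w)"
    if w: "fst ` set w \<subseteq> {1..n}" for x w
  proof (cases "\<exists>v. w = inv_letter x # v")
    case True
    then obtain v where v: "w = inv_letter x # v" by blast
    then have "reduced_word (?E v)" using closed[of v] w by (simp add: carrier_free_group)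
    then show ?thesis using v cancel by simp
  next
    case False
    then show ?thesis by (cases w) auto
  qed
  have mult: "?E (foldr push v w) = foldr push (?E v) (?E w)"
    if "fst ` set v \<subseteq> {1..n}" "fst ` set w \<subseteq> {1..n}" for v w
    using that
  proof (induction v)
    case (Cons x v)
    have "fst ` set (foldr push v w) \<subseteq> {1..n}"
      using Cons.prems set_foldr_push[of v w] by fastforce
    then have "?E (foldr push (x # v) w) = foldr push (letter_image u x) (?E (foldr push v w))"
      using push by simp
    also have "\<dots> = foldr push (letter_image u x) (foldr push (?E v) (?E w))"
      using Cons by simp
    also have "\<dots> = foldr push (?E (x # v)) (?E w)"
      using closed[of w] Cons.prems by (simp add: foldr_push_assoc carrier_free_group)
    finally show ?case .
  qed simp
  show ?thesis
  proof (rule homI)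
    fix v w assume "v \<in> carrier (free_group n)" "w \<in> carrier (free_group n)"
    then show "extend_hom n u (v \<otimes>\<^bsub>free_group n\<^esub> w)
        = extend_hom n u v \<otimes>\<^bsub>free_group n\<^esub> extend_hom n u w"
      using mult[of v w] mult_closed_free_group[of v n w]
      by (auto simp: extend_hom_def carrier_free_group)
  next
    fix w assume "w \<in> carrier (free_group n)"
    then show "extend_hom n u w \<in> carrier (free_group n)"
      using closed[of w] by (auto simp: extend_hom_def carrier_free_group)
  qed
qed

section \<open>Generators of the basis-conjugating automorphism group\<close>

lemma carrier_P_Sigma:
  "\<phi> \<in> carrier (P_Sigma n) \<longleftrightarrow> \<phi> \<in> hom (free_group n) (free_group n)
    \<and> \<phi> \<in> extensional (carrier (free_group n))
    \<and> bij_betw \<phi> (carrier (free_group n)) (carrier (free_group n))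
    \<and> (\<forall>i\<in>{1..n}. \<exists>w\<in>carrier (free_group n). \<phi> (gen i) = conj_word i w)"
proof -
  have "(\<forall>i\<in>{1..n}. \<exists>w\<in>carrier (free_group n). \<phi> (gen i)
      = inv\<^bsub>free_group n\<^esub> w \<otimes>\<^bsub>free_group n\<^esub> gen i \<otimes>\<^bsub>free_group n\<^esub> w)
    \<longleftrightarrow> (\<forall>i\<in>{1..n}. \<exists>w\<in>carrier (free_group n). \<phi> (gen i) = conj_word i w)"
    by (intro ball_cong bex_cong refl) (use conj_word_eq_conj in metis)
  then show ?thesis
    by (auto simp: P_Sigma_def auto_def Bij_def simp del: mult_free_group)
qed

lemma P_SigmaD:
  assumes "\<phi> \<in> carrier (P_Sigma n)"
  shows "\<phi> \<in> hom (free_group n) (free_group n)"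
    "\<And>i. i \<in> {1..n} \<Longrightarrow> \<exists>w\<in>carrier (free_group n). \<phi> (gen i) = conj_word i w"
  using assms by (auto simp: carrier_P_Sigma)

lemma P_Sigma_eqI:
  assumes "\<phi> \<in> carrier (P_Sigma n)" "\<psi> \<in> carrier (P_Sigma n)"
    and "\<And>i. i \<in> {1..n} \<Longrightarrow> \<phi> (gen i) = \<psi> (gen i)"
  shows "\<phi> = \<psi>"
proof (rule extensionalityI)
  show "\<phi> \<in> extensional (carrier (free_group n))" "\<psi> \<in> extensional (carrier (free_group n))"
    using assms by (auto simp: carrier_P_Sigma)
  show "\<phi> w = \<psi> w" if "w \<in> carrier (free_group n)" for w
    by (rule hom_free_group_eqI[of _ n]) (use assms P_SigmaD(1) that in auto)
qed

lemma mult_P_Sigma: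
  assumes "\<phi> \<in> carrier (P_Sigma n)" "\<psi> \<in> carrier (P_Sigma n)"
  shows "\<phi> \<otimes>\<^bsub>P_Sigma n\<^esub> \<psi> = compose (carrier (free_group n)) \<phi> \<psi>"
  using assms by (simp add: carrier_P_Sigma) (simp add: P_Sigma_def AutoGroup_def BijGroup_def Bij_def)

lemma mult_P_Sigma_apply:
  assumes "\<phi> \<in> carrier (P_Sigma n)" "\<psi> \<in> carrier (P_Sigma n)" "w \<in> carrier (free_group n)"
  shows "(\<phi> \<otimes>\<^bsub>P_Sigma n\<^esub> \<psi>) w = \<phi> (\<psi> w)"
  using assms by (simp add: mult_P_Sigma compose_eq)

lemma mult_P_Sigma_gen:
  assumes "\<phi> \<in> carrier (P_Sigma n)" "\<psi> \<in> carrier (P_Sigma n)" "i \<in> {1..n}"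
    "u \<in> carrier (free_group n)" "\<phi> (gen i) = conj_word i u"
    "w \<in> carrier (free_group n)" "\<psi> (gen i) = conj_word i w"
  shows "(\<phi> \<otimes>\<^bsub>P_Sigma n\<^esub> \<psi>) (gen i) = conj_word i (foldr push u (\<phi> w))"
  using assms hom_free_group_conj_word[OF P_SigmaD(1)[OF assms(1)] assms(6,3,4,5)]
  by (simp add: mult_P_Sigma_apply gen_closed)

lemma mult_closed_P_Sigma:
  assumes "\<phi> \<in> carrier (P_Sigma n)" "\<psi> \<in> carrier (P_Sigma n)"
  shows "\<phi> \<otimes>\<^bsub>P_Sigma n\<^esub> \<psi> \<in> carrier (P_Sigma n)"
  unfolding carrier_P_Sigma
proof (intro conjI ballI)
  interpret F: group "free_group n" by (rule group_free_group)
  show "\<phi> \<otimes>\<^bsub>P_Sigma n\<^esub> \<psi> \<in> hom (free_group n) (free_group n)"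
    using F.hom_compose[OF P_SigmaD(1)[OF assms(2)] P_SigmaD(1)[OF assms(1)]] assms
    by (simp add: mult_P_Sigma)
  show "\<phi> \<otimes>\<^bsub>P_Sigma n\<^esub> \<psi> \<in> extensional (carrier (free_group n))"
    using assms by (simp add: mult_P_Sigma)
  show "bij_betw (\<phi> \<otimes>\<^bsub>P_Sigma n\<^esub> \<psi>) (carrier (free_group n)) (carrier (free_group n))"
    using assms by (simp add: mult_P_Sigma) (auto intro: bij_betw_compose simp: carrier_P_Sigma)
  fix i assume i: "i \<in> {1..n}"
  obtain u where u: "u \<in> carrier (free_group n)" "\<phi> (gen i) = conj_word i u"
    using P_SigmaD(2)[OF assms(1) i] by blast
  obtain w where w: "w \<in> carrier (free_group n)" "\<psi> (gen i) = conj_word i w"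
    using P_SigmaD(2)[OF assms(2) i] by blast
  show "\<exists>w\<in>carrier (free_group n). (\<phi> \<otimes>\<^bsub>P_Sigma n\<^esub> \<psi>) (gen i) = conj_word i w"
    using mult_P_Sigma_gen[OF assms i u w]
      mult_closed_free_group[OF u(1) hom_free_group_closed[OF P_SigmaD(1)[OF assms(1)] w(1)]]
    by blast
qed

lemma one_P_Sigma_apply: "w \<in> carrier (free_group n) \<Longrightarrow> \<one>\<^bsub>P_Sigma n\<^esub> w = w"
  by (simp add: P_Sigma_def AutoGroup_def BijGroup_def)

lemma one_closed_P_Sigma: "\<one>\<^bsub>P_Sigma n\<^esub> \<in> carrier (P_Sigma n)"
proof -
  interpret F: group "free_group n" by (rule group_free_group)
  have "\<one>\<^bsub>P_Sigma n\<^esub> \<in> auto (free_group n)"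
    using F.id_in_auto by (simp add: P_Sigma_def AutoGroup_def BijGroup_def)
  moreover have "\<forall>i\<in>{1..n}. \<exists>w\<in>carrier (free_group n). \<one>\<^bsub>P_Sigma n\<^esub> (gen i) = conj_word i w"
  proof
    fix i assume "i \<in> {1..n}"
    then show "\<exists>w\<in>carrier (free_group n). \<one>\<^bsub>P_Sigma n\<^esub> (gen i) = conj_word i w"
      using one_P_Sigma_apply[OF gen_closed, of i n]
      by (intro bexI[of _ "[]"]) (auto simp: carrier_free_group)
  qed
  ultimately show ?thesis
    by (auto simp: carrier_P_Sigma auto_def Bij_def)
qed

text \<open>The conjugating letter may be an inverse, so the twists comprise the beta_pq together
  with their inverses: \<open>inv_letter x\<close> gives the inverse of the twist by
  \<open>x\<close>.\<close>

definition twist :: "nat \<Rightarrow> nat \<Rightarrow> nat \<times> bool \<Rightarrow> word \<Rightarrow> word" where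
  "twist n p x = extend_hom n (\<lambda>i. conj_word i (if i = p then [x] else []))"

lemma
  assumes "fst x \<in> {1..n}"
  shows twist_gen: "i \<in> {1..n} \<Longrightarrow> twist n p x (gen i) = conj_word i (if i = p then [x] else [])"
    and twist_hom: "twist n p x \<in> hom (free_group n) (free_group n)"
proof -
  have "(if i = p then [x] else []) \<in> carrier (free_group n)" for i
    using letter_closed[OF assms] by (cases "i = p") (simp_all add: carrier_free_group)
  then have c: "conj_word i (if i = p then [x] else []) \<in> carrier (free_group n)" if "i \<in> {1..n}" for i
    using conj_word_closed that by blast
  show "twist n p x (gen i) = conj_word i (if i = p then [x] else [])" if "i \<in> {1..n}"
    unfolding twist_def
    using extend_hom_gen[where u = "\<lambda>i. conj_word i (if i = p then [x] else [])", OF that c[OF that]] .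
  show "twist n p x \<in> hom (free_group n) (free_group n)"
    unfolding twist_def
    using extend_hom_hom[where u = "\<lambda>i. conj_word i (if i = p then [x] else [])", OF c] .
qed

lemma twist_letter:
  assumes "fst x \<in> {1..n}" "fst y \<in> {1..n}" "fst y \<noteq> p"
  shows "twist n p x [y] = [y]"
proof -
  have "twist n p x (gen (fst y)) = gen (fst y)"
    using assms by (simp add: twist_gen)
  then show ?thesis
    using hom_free_group_letter[OF twist_hom[OF assms(1)] assms(2), of p]
    by (cases y) (auto simp: gen_def word_inv_def inv_letter_def)
qed

text \<open>The twist at p fixes the letter x, because its index differs from p. So the conjugators
  simply multiply, and x cancels its inverse.\<close>

lemma twist_twist_inverse:
  assumes "fst x \<in> {1..n}" "fst x \<noteq> p" "w \<in> carrier (free_group n)"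
  shows "twist n p x (twist n p (inv_letter x) w) = w"
proof -
  interpret F: group "free_group n" by (rule group_free_group)
  let ?\<phi> = "twist n p x" and ?\<psi> = "twist n p (inv_letter x)"
  have hom: "?\<phi> \<in> hom (free_group n) (free_group n)" "?\<psi> \<in> hom (free_group n) (free_group n)"
    using assms by (auto intro: twist_hom)
  have gen: "?\<phi> (?\<psi> (gen i)) = gen i" if i: "i \<in> {1..n}" for i
  proof (cases "i = p")
    case True
    have "?\<phi> (conj_word i [inv_letter x]) = conj_word i (foldr push [x] (?\<phi> [inv_letter x]))"
      using assms i True by (intro hom_free_group_conj_word[OF hom(1)] letter_closed) (auto simp: twist_gen)
    also have "\<dots> = gen i"
      using assms by (simp add: twist_letter)
    finally show ?thesis using assms i True by (simp add: twist_gen)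
  next
    case False
    then show ?thesis using assms i by (simp add: twist_gen)
  qed
  have "compose (carrier (free_group n)) ?\<phi> ?\<psi> \<in> hom (free_group n) (free_group n)"
    using F.hom_compose[OF hom(2,1)] .
  then have "compose (carrier (free_group n)) ?\<phi> ?\<psi> w = (\<lambda>x\<in>carrier (free_group n). x) w"
  proof (rule hom_free_group_eqI[where n = n])
    show "(\<lambda>x\<in>carrier (free_group n). x) \<in> hom (free_group n) (free_group n)"
      using F.id_in_auto by (simp add: auto_def)
  qed (use gen assms(3) gen_closed in \<open>simp_all add: compose_eq\<close>)
  then show ?thesis using assms(3) by (simp add: compose_eq)
qed

lemma twist_closed:
  assumes x: "fst x \<in> {1..n}" "fst x \<noteq> p"
  shows "twist n p x \<in> carrier (P_Sigma n)"
  unfolding carrier_P_Sigma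
proof (intro conjI ballI)
  show "bij_betw (twist n p x) (carrier (free_group n)) (carrier (free_group n))"
  proof (rule bij_betw_byWitness[where f' = "twist n p (inv_letter x)"])
    show "\<forall>w\<in>carrier (free_group n). twist n p (inv_letter x) (twist n p x w) = w"
      using twist_twist_inverse[of "inv_letter x" n p] x by simp
    show "\<forall>w\<in>carrier (free_group n). twist n p x (twist n p (inv_letter x) w) = w"
      using twist_twist_inverse x by simp
  qed (use twist_hom[of x n p] twist_hom[of "inv_letter x" n p] x hom_free_group_closed in auto)
  show "\<exists>w\<in>carrier (free_group n). twist n p x (gen i) = conj_word i w" if "i \<in> {1..n}" for i
  proof (rule bexI)
    show "twist n p x (gen i) = conj_word i (if i = p then [x] else [])"
      using that x by (simp add: twist_gen)
    show "(if i = p then [x] else []) \<in> carrier (free_group n)"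
      using letter_closed[OF x(1)] by (cases "i = p") (simp_all add: carrier_free_group)
  qed
  show "twist n p x \<in> hom (free_group n) (free_group n)"
    using x by (simp add: twist_hom)
  show "twist n p x \<in> extensional (carrier (free_group n))"
    by (simp add: twist_def extend_hom_def)
qed

lemma twist_mult_twist_inverse:
  assumes "fst x \<in> {1..n}" "fst x \<noteq> p"
  shows "twist n p x \<otimes>\<^bsub>P_Sigma n\<^esub> twist n p (inv_letter x) = \<one>\<^bsub>P_Sigma n\<^esub>"
proof (rule P_Sigma_eqI)
  show "twist n p x \<otimes>\<^bsub>P_Sigma n\<^esub> twist n p (inv_letter x) \<in> carrier (P_Sigma n)"
    using assms by (intro mult_closed_P_Sigma twist_closed) auto
  show "\<one>\<^bsub>P_Sigma n\<^esub> \<in> carrier (P_Sigma n)" by (rule one_closed_P_Sigma)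
  show "(twist n p x \<otimes>\<^bsub>P_Sigma n\<^esub> twist n p (inv_letter x)) (gen i) = \<one>\<^bsub>P_Sigma n\<^esub> (gen i)"
    if "i \<in> {1..n}" for i
    using assms twist_closed[of x n p] twist_closed[of "inv_letter x" n p] gen_closed[OF that]
    by (simp add: mult_P_Sigma_apply twist_twist_inverse one_P_Sigma_apply)
qed

lemma beta_eq_twist:
  assumes "p \<in> {1..n}" "q \<in> {1..n}" "p \<noteq> q"
  shows "beta n p q = twist n p (q, True)"
  unfolding beta_def
proof (rule the_equality)
  have q: "inv\<^bsub>free_group n\<^esub> gen q \<otimes>\<^bsub>free_group n\<^esub> gen p \<otimes>\<^bsub>free_group n\<^esub> gen q
      = conj_word p [(q, True)]"
    using conj_word_eq_conj[OF gen_closed, of q n p] assms by (simp add: gen_def)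
  have t: "twist n p (q, True) \<in> carrier (P_Sigma n)"
    using assms by (intro twist_closed) auto
  show "twist n p (q, True) \<in> carrier (P_Sigma n)
    \<and> twist n p (q, True) (gen p)
      = inv\<^bsub>free_group n\<^esub> gen q \<otimes>\<^bsub>free_group n\<^esub> gen p \<otimes>\<^bsub>free_group n\<^esub> gen q
    \<and> (\<forall>k\<in>{1..n}. k \<noteq> p \<longrightarrow> twist n p (q, True) (gen k) = gen k)"
    unfolding q using t assms by (simp add: twist_gen)
  fix \<phi>
  assume "\<phi> \<in> carrier (P_Sigma n)
    \<and> \<phi> (gen p) = inv\<^bsub>free_group n\<^esub> gen q \<otimes>\<^bsub>free_group n\<^esub> gen p \<otimes>\<^bsub>free_group n\<^esub> gen q
    \<and> (\<forall>k\<in>{1..n}. k \<noteq> p \<longrightarrow> \<phi> (gen k) = gen k)"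
  then show "\<phi> = twist n p (q, True)"
    unfolding q using t assms by (intro P_Sigma_eqI[of _ n]) (auto simp: twist_gen)
qed

section \<open>The twists generate\<close>

text \<open>A leading power of x_i in a conjugator of x_i commutes with x_i and can be removed
  without changing the conjugate. After that, w^-1 x_i w is reduced as it stands.\<close>

definition normal_conjugator :: "nat \<Rightarrow> word \<Rightarrow> bool" where
  "normal_conjugator i w \<longleftrightarrow> w = [] \<or> fst (hd w) \<noteq> i"

section \<open>Reduced forms of products and conjugates\<close>

lemma foldr_push_append: "reduced_word (u @ v) \<Longrightarrow> foldr push u v = u @ v"
proof (induction u)
  case (Cons x u)
  then show ?case by (cases "u @ v") (auto simp: reduced_word_Cons)
qed simp

lemma foldr_push_append_Cons:
  assumes "reduced_word (u @ [x])" "reduced_word (x # v)"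
  shows "foldr push u (x # v) = u @ x # v"
  using assms by (intro foldr_push_append) (auto simp: reduced_word_append)

lemma length_push: "length (push x w) \<le> Suc (length w)"
  by (cases w) auto

lemma length_foldr_push: "length (foldr push u v) \<le> length u + length v"
proof (induction u)
  case (Cons x u)
  then show ?case using length_push[of x "foldr push u v"] by simp
qed simp

lemma word_inv_append: "word_inv (u @ v) = word_inv v @ word_inv u"
  by (simp add: word_inv_def)

lemma word_inv_Cons: "word_inv (x # v) = word_inv v @ [inv_letter x]"
  by (simp add: word_inv_def)

lemma word_inv_Nil [simp]: "word_inv [] = []"
  by (simp add: word_inv_def)

lemma word_inv_Nil_iff [simp]: "word_inv w = [] \<longleftrightarrow> w = []"
  by (simp add: word_inv_def)

lemma last_word_inv: "w \<noteq> [] \<Longrightarrow> last (word_inv w) = inv_letter (hd w)"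
  by (simp add: word_inv_def last_map last_rev)

lemma hd_word_inv: "w \<noteq> [] \<Longrightarrow> hd (word_inv w) = inv_letter (last w)"
  by (simp add: word_inv_def hd_map hd_rev)

lemma inv_letter_eq_iff: "fst x = fst y \<Longrightarrow> y \<noteq> inv_letter x \<longleftrightarrow> y = x"
  by (cases x; cases y) (auto simp: inv_letter_def)

lemma inv_letter_inject [simp]: "inv_letter x = inv_letter y \<longleftrightarrow> x = y"
  by (metis inv_letter_inv_letter)

lemma normal_conjugator_exists:
  assumes "w \<in> carrier (free_group n)"
  shows "\<exists>v\<in>carrier (free_group n). normal_conjugator i v \<and> conj_word i v = conj_word i w
    \<and> length v \<le> length w"
  using assms
proof (induction w)
  case Nil
  then show ?case by (intro bexI[of _ "[]"]) (auto simp: normal_conjugator_def)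
next
  case (Cons x w)
  then have w: "w \<in> carrier (free_group n)" and red: "reduced_word w" "reduced_word (x # w)"
    by (auto simp: carrier_free_group reduced_word_Cons)
  show ?case
  proof (cases "fst x = i")
    case False
    then show ?thesis using Cons.prems by (intro bexI[of _ "x # w"]) (auto simp: normal_conjugator_def)
  next
    case True
    have xw: "x # w = push x w"
      using red by (cases w) (auto simp: reduced_word_Cons)
    have "push (inv_letter x) (push (i, True) (push x w)) = push (i, True) w"
    proof (cases "snd x")
      case b: True
      then have "x = (i, True)" using True by (simp add: prod_eq_iff)
      then show ?thesis using push_push'[OF reduced_push[OF red(1)]] by simp
    next
      case b: False
      then have "x = inv_letter (i, True)" using True by (simp add: prod_eq_iff inv_letter_def)
      then show ?thesis using push_push[OF red(1)] by simp
    qed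
    then have "conj_word i (x # w) = conj_word i w"
      unfolding conj_word_def by (simp add: word_inv_Cons gen_def xw[symmetric] del: push.simps)
    then show ?thesis using Cons.IH[OF w] by auto
  qed
qed

lemma conj_word_normal:
  assumes "w \<in> carrier (free_group n)" "normal_conjugator i w" "fst x = i"
  shows "reduced_word (word_inv w @ [x])" "reduced_word (x # w)"
    and "conj_word i w = word_inv w @ (i, True) # w"
proof -
  have *: "reduced_word (word_inv w @ [x])" "reduced_word (x # w)" if "fst x = i" for x
    using assms(1,2) that reduced_word_word_inv[of w]
    by (auto simp: reduced_word_append reduced_word_Cons last_word_inv normal_conjugator_def
        carrier_free_group)
  then show "reduced_word (word_inv w @ [x])" "reduced_word (x # w)" using assms(3) by auto
  have "conj_word i w = foldr push (word_inv w) (push (i, True) w)"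
    by (simp add: conj_word_def gen_def)
  also have "push (i, True) w = (i, True) # w"
    using foldr_push_append[of "[(i, True)]" w] *(2)[of "(i, True)"] by simp
  finally show "conj_word i w = word_inv w @ (i, True) # w"
    using foldr_push_append_Cons *[of "(i, True)"] by simp
qed

text \<open>For reduced words, the cancellation in u v^-1 removes exactly the common suffix s; the
  condition on the last letters says that it stops there.\<close>

lemma common_suffix:
  obtains p q s where "u = p @ s" "v = q @ s" "p = [] \<or> q = [] \<or> last p \<noteq> last q"
proof -
  have "\<exists>p q s. u = p @ s \<and> v = q @ s \<and> (p = [] \<or> q = [] \<or> last p \<noteq> last q)"
  proof (induction u arbitrary: v rule: rev_induct)
    case Nil
    then show ?case by (intro exI[of _ "[]"] exI[of _ v]) simp
  next
    case (snoc x u)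
    show ?case
    proof (cases "v \<noteq> [] \<and> last v = x")
      case True
      then obtain v' where v: "v = v' @ [x]" by (metis append_butlast_last_id)
      obtain p q s where "u = p @ s" "v' = q @ s" "p = [] \<or> q = [] \<or> last p \<noteq> last q"
        using snoc by blast
      then show ?thesis using v by (intro exI[of _ p] exI[of _ q] exI[of _ "s @ [x]"]) simp
    next
      case False
      then show ?thesis by (intro exI[of _ "u @ [x]"] exI[of _ v] exI[of _ "[]"]) auto
    qed
  qed
  then show thesis using that by blast
qed

text \<open>
  If no conjugator absorbs part of another one, then the conjugators survive as prefixes of the
  images of all words, so that a surjective \<open>\<phi>\<close> has only trivial conjugators.
\<close>

lemma image_of_word_without_absorption:
  assumes \<phi>: "\<phi> \<in> hom (free_group n) (free_group n)"
    and w: "\<And>i. i \<in> {1..n} \<Longrightarrow> w i \<in> carrier (free_group n)"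
    and normal: "\<And>i. i \<in> {1..n} \<Longrightarrow> normal_conjugator i (w i)"
    and gen: "\<And>i. i \<in> {1..n} \<Longrightarrow> \<phi> (gen i) = conj_word i (w i)"
    and no_absorption: "\<And>i y v. \<lbrakk>i \<in> {1..n}; fst y \<in> {1..n}; i \<noteq> fst y\<rbrakk> \<Longrightarrow> w i \<noteq> v @ y # w (fst y)"
    and "x # v \<in> carrier (free_group n)"
  shows "\<exists>t. \<phi> (x # v) = word_inv (w (fst x)) @ x # t"
  using assms(6)
proof (induction v arbitrary: x)
  case (Nil x)
  then have "fst x \<in> {1..n}" by (simp add: carrier_free_group)
  then have "\<phi> [x] = word_inv (w (fst x)) @ x # w (fst x)"
    using hom_free_group_letter[OF \<phi>] gen conj_word_normal(3)[OF w normal refl]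
    by (cases x) (auto simp: word_inv_append word_inv_Cons inv_letter_def)
  then show ?case by blast
next
  case (Cons y v x)
  have x: "fst x \<in> {1..n}" and y: "fst y \<in> {1..n}" and v: "y # v \<in> carrier (free_group n)"
    and yx: "y \<noteq> inv_letter x"
    using Cons.prems by (auto simp: carrier_free_group reduced_word_Cons)
  let ?wx = "w (fst x)" and ?wy = "w (fst y)"
  have \<phi>x: "\<phi> [x] = word_inv ?wx @ x # ?wx"
    using hom_free_group_letter[OF \<phi>] x gen conj_word_normal(3)[OF w normal refl]
    by (cases x) (auto simp: word_inv_append word_inv_Cons inv_letter_def)
  obtain t where t: "\<phi> (y # v) = word_inv ?wy @ y # t"
    using Cons.IH[OF v] by blast
  have red: "reduced_word (word_inv ?wy @ y # t)"
    using hom_free_group_closed[OF \<phi> v] unfolding t by (simp add: carrier_free_group)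
  have rx: "reduced_word (word_inv ?wx @ [x])"
    using conj_word_normal(1)[OF w normal refl] x by blast
  have start: "\<phi> (x # y # v) = word_inv ?wx @ x # foldr push ?wx (word_inv ?wy @ y # t)"
    if "reduced_word (x # foldr push ?wx (word_inv ?wy @ y # t))"
  proof -
    have "\<phi> (x # y # v) = foldr push (word_inv ?wx) (push x (foldr push ?wx (word_inv ?wy @ y # t)))"
      using hom_free_group_Cons[OF \<phi> Cons.prems] by (simp add: \<phi>x t)
    also have "push x (foldr push ?wx (word_inv ?wy @ y # t)) = x # foldr push ?wx (word_inv ?wy @ y # t)"
      using foldr_push_append[of "[x]"] that by simp
    finally show ?thesis using foldr_push_append_Cons[OF rx that] by simp
  qed
  have "reduced_word (x # foldr push ?wx (word_inv ?wy @ y # t))"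
  proof (cases "fst x = fst y")
    case True
    \<comment> \<open>Neighbours in a reduced word with the same index are equal, so the conjugator
      at the end of \<phi>(x) cancels its inverse at the start of \<phi>(y v).\<close>
    then have "y = x" using inv_letter_eq_iff yx by blast
    have r: "reduced_word (x # t)" using red \<open>y = x\<close> by (simp add: reduced_word_append)
    have "word_inv ?wx @ x # t = foldr push (word_inv ?wx) (x # t)"
      using foldr_push_append_Cons[OF rx r] by simp
    then have "foldr push ?wx (word_inv ?wx @ x # t) = x # t"
      using foldr_push_inverse[OF r, of "word_inv ?wx"] by (simp flip: word_inv_def)
    then show ?thesis using r \<open>y = x\<close> by (simp add: reduced_word_Cons)
  next
    case False
    obtain p q s where pqs: "?wx = p @ s" "?wy = q @ s" "p = [] \<or> q = [] \<or> last p \<noteq> last q"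
      using common_suffix by blast
    have rq: "reduced_word (word_inv q @ y # t)"
      using red by (simp add: pqs word_inv_append reduced_word_append)
    have "word_inv ?wy @ y # t = foldr push (word_inv s) (word_inv q @ y # t)"
      using foldr_push_append[of "word_inv s" "word_inv q @ y # t"] red
      by (simp add: pqs word_inv_append)
    then have eq: "foldr push ?wx (word_inv ?wy @ y # t) = foldr push p (word_inv q @ y # t)"
      using foldr_push_inverse[OF rq, of "word_inv s"] by (simp add: pqs flip: word_inv_def)
    have rp: "reduced_word p"
      using w[OF x] by (simp add: pqs carrier_free_group reduced_word_append)
    have "reduced_word (p @ word_inv q @ y # t)"
    proof -
      \<comment> \<open>If q is empty, p is followed by y itself. A cancellation there would exhibit
        \<open>?wx\<close> as a word ending in the inverse of y followed by \<open>?wy\<close>,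
        which is an absorption.\<close>
      have "y \<noteq> inv_letter (last p)" if "q = []" "p \<noteq> []"
      proof
        assume "y = inv_letter (last p)"
        then have "?wx = butlast p @ inv_letter y # ?wy"
          using that pqs by simp
        then show False using no_absorption[OF x, of "inv_letter y" "butlast p"] False y by simp
      qed
      then show ?thesis
        using rp rq pqs(3) by (cases "q = []") (auto simp: reduced_word_append hd_word_inv)
    qed
    moreover have "hd (p @ word_inv q @ y # t) \<noteq> inv_letter x"
    proof (cases "p = []")
      case p: False
      then have "fst (hd p) \<noteq> fst x" using normal[OF x] pqs by (simp add: normal_conjugator_def)
      then show ?thesis using p by auto
    next
      case p: True
      show ?thesis
      proof (cases "q = []")
        case True
        then show ?thesis using p False by auto
      next
        case q: False
        \<comment> \<open>With p empty, the letter after x is the inverse of the last letter of q. A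
          cancellation would mean that \<open>?wy\<close> ends in x followed by \<open>?wx\<close>,
          again an absorption.\<close>
        have "last q \<noteq> x"
        proof
          assume "last q = x"
          then have "?wy = butlast q @ x # ?wx"
            using append_butlast_last_id[OF q] p pqs by (metis append.assoc append_Cons append_Nil)
          then show False using no_absorption[OF y, of x] False x by auto
        qed
        then show ?thesis using p q by (simp add: hd_word_inv)
      qed
    qed
    ultimately have "reduced_word (x # p @ word_inv q @ y # t)"
      by (simp add: reduced_word_Cons)
    moreover have "foldr push p (word_inv q @ y # t) = p @ word_inv q @ y # t"
      using \<open>reduced_word (p @ word_inv q @ y # t)\<close> by (rule foldr_push_append)
    ultimately show ?thesis using eq by simp
  qed
  then show ?case using start by blast
qed

text \<open>The step leads from the product back to \<phi>, because \<phi> is shortened by right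
  factors. If u_i = v y u_y, where u_y is the conjugator belonging to the letter y, the twist at i
  by y^-1 replaces u_i by u_i \<phi>(y^-1) = v y u_y (u_y^-1 y^-1 u_y) = v u_y, and no other
  conjugator changes.\<close>

lemma P_Sigma_induct [consumes 1, case_names one twist]:
  assumes "\<phi> \<in> carrier (P_Sigma n)"
    and one: "P \<one>\<^bsub>P_Sigma n\<^esub>"
    and twist: "\<And>\<phi> p x. \<lbrakk>\<phi> \<in> carrier (P_Sigma n); p \<in> {1..n}; fst x \<in> {1..n}; fst x \<noteq> p;
      P (\<phi> \<otimes>\<^bsub>P_Sigma n\<^esub> twist n p x)\<rbrakk> \<Longrightarrow> P \<phi>"
  shows "P \<phi>"
proof -
  \<comment> \<open>The induction runs over \<phi> together with a choice of conjugators, since the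
    measure, their total length, depends on the choice.\<close>
  have "P \<phi>" if "\<phi> \<in> carrier (P_Sigma n)"
    "\<And>i. i \<in> {1..n} \<Longrightarrow> w i \<in> carrier (free_group n) \<and> \<phi> (gen i) = conj_word i (w i)"
  for \<phi> and w :: "nat \<Rightarrow> word"
    using that
  proof (induction "\<Sum>i\<in>{1..n}. length (w i)" arbitrary: \<phi> w rule: less_induct)
    case less
    have "\<forall>i. \<exists>v. i \<in> {1..n} \<longrightarrow> v \<in> carrier (free_group n) \<and> normal_conjugator i v
        \<and> conj_word i v = conj_word i (w i) \<and> length v \<le> length (w i)"
      using normal_conjugator_exists less.prems(2) by meson
    then obtain u where u: "\<And>i. i \<in> {1..n} \<Longrightarrow> u i \<in> carrier (free_group n) \<and> normal_conjugator i (u i)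
        \<and> conj_word i (u i) = conj_word i (w i) \<and> length (u i) \<le> length (w i)"
      by metis
    have gen: "\<phi> (gen i) = conj_word i (u i)" if "i \<in> {1..n}" for i
      using u less.prems(2) that by simp
    have \<phi>: "\<phi> \<in> hom (free_group n) (free_group n)" using P_SigmaD(1)[OF less.prems(1)] .
    show ?case
    proof (cases "\<exists>i y v. i \<in> {1..n} \<and> fst y \<in> {1..n} \<and> i \<noteq> fst y \<and> u i = v @ y # u (fst y)")
      case True
      then obtain i y v where iy: "i \<in> {1..n}" "fst y \<in> {1..n}" "i \<noteq> fst y" "u i = v @ y # u (fst y)"
        by blast
      let ?uy = "u (fst y)" and ?x = "inv_letter y"
      let ?\<psi> = "\<phi> \<otimes>\<^bsub>P_Sigma n\<^esub> twist n i ?x"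
      have t: "twist n i ?x \<in> carrier (P_Sigma n)" using iy by (intro twist_closed) auto
      have \<phi>x: "\<phi> [?x] = word_inv ?uy @ ?x # ?uy"
        using hom_free_group_letter[OF \<phi>, of ?x] iy gen[of "fst y"] conj_word_normal(3)[of ?uy n "fst y" y]
          u[of "fst y"]
        by (cases y) (auto simp: word_inv_append word_inv_Cons inv_letter_def)
      have red: "reduced_word (u i)" using u[OF iy(1)] by (simp add: carrier_free_group)
      then have red': "reduced_word v" "reduced_word (y # ?uy)" using iy(4) by (auto simp: reduced_word_append)
      have rx: "reduced_word (word_inv ?uy @ [?x])" "reduced_word (?x # ?uy)"
        using conj_word_normal(1,2)[of ?uy n "fst y" ?x] u[of "fst y"] iy by auto
      have "word_inv ?uy @ ?x # ?uy = foldr push (word_inv ?uy) (?x # ?uy)"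
        using foldr_push_append_Cons[OF rx] by simp
      then have "foldr push ?uy (\<phi> [?x]) = ?x # ?uy"
        unfolding \<phi>x using foldr_push_inverse[OF rx(2), of "word_inv ?uy"] by (simp flip: word_inv_def)
      then have uv: "foldr push (u i) (\<phi> [?x]) = foldr push v ?uy"
        by (simp add: iy(4))
      have "length (foldr push v ?uy) < length (u i)"
        using length_foldr_push[of v ?uy] by (simp add: iy(4))
      also have "\<dots> \<le> length (w i)" using u iy by blast
      finally have lt: "length (foldr push v ?uy) < length (w i)" .
      let ?w = "u(i := foldr push v ?uy)"
      have "(\<Sum>k\<in>{1..n}. length (?w k)) < (\<Sum>k\<in>{1..n}. length (w k))"
      proof (rule sum_strict_mono_ex1)
        show "\<forall>k\<in>{1..n}. length (?w k) \<le> length (w k)"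
          using u lt by auto
        show "\<exists>k\<in>{1..n}. length (?w k) < length (w k)"
          using lt iy by auto
      qed simp
      moreover have "?\<psi> \<in> carrier (P_Sigma n)" using less.prems(1) t by (rule mult_closed_P_Sigma)
      moreover have "?w k \<in> carrier (free_group n) \<and> ?\<psi> (gen k) = conj_word k (?w k)"
        if k: "k \<in> {1..n}" for k
      proof (cases "k = i")
        case True
        have c: "[?x] \<in> carrier (free_group n)" using letter_closed iy by simp
        have "?\<psi> (gen i) = conj_word i (foldr push (u i) (\<phi> [?x]))"
          using less.prems(1) t iy(1) u gen c iy(2)
          by (intro mult_P_Sigma_gen) (auto simp: twist_gen)
        moreover have "foldr push (u i) (\<phi> [?x]) \<in> carrier (free_group n)"
          using u[OF iy(1)] hom_free_group_closed[OF \<phi> c] by (intro mult_closed_free_group) blast+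
        ultimately show ?thesis using True uv by simp
      next
        case False
        have c: "[] \<in> carrier (free_group n)" by (simp add: carrier_free_group)
        have "?\<psi> (gen k) = conj_word k (foldr push (u k) (\<phi> []))"
          using less.prems(1) t k u gen c False iy(2)
          by (intro mult_P_Sigma_gen) (auto simp: twist_gen)
        then show ?thesis
          using False u[OF k] by (simp add: hom_free_group_Nil[OF \<phi>] foldr_push_Nil carrier_free_group)
      qed
      ultimately have "P ?\<psi>" using less.hyps[of ?w ?\<psi>] by blast
      then show "P \<phi>" using twist[OF less.prems(1) iy(1), of ?x] iy by simp
    next
      case False
      have "u k = []" if k: "k \<in> {1..n}" for k
      proof -
        \<comment> \<open>Surjectivity enters here. The image of a preimage of x_k starts with the
          inverse of a conjugator followed by the letter x; as it has only one letter, the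
          conjugator is empty and x is x_k.\<close>
        have "gen k \<in> \<phi> ` carrier (free_group n)"
          using less.prems(1) gen_closed[OF k] by (auto simp: carrier_P_Sigma bij_betw_def)
        then obtain v where v: "v \<in> carrier (free_group n)" "\<phi> v = gen k" by force
        then have "v \<noteq> []" using hom_free_group_Nil[OF \<phi>] by (auto simp: gen_def)
        then obtain x v' where x: "v = x # v'" by (cases v) auto
        obtain t where "\<phi> v = word_inv (u (fst x)) @ x # t"
          using image_of_word_without_absorption[OF \<phi>, of u x v'] u gen False v x by blast
        then have "word_inv (u (fst x)) @ x # t = [(k, True)]" using v by (simp add: gen_def)
        then have "u (fst x) = []" "x = (k, True)"
          by (auto simp: append_eq_Cons_conv)
        then show ?thesis by simp
      qed
      then have "\<phi> = \<one>\<^bsub>P_Sigma n\<^esub>"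
        using gen less.prems(1) one_closed_P_Sigma gen_closed
        by (intro P_Sigma_eqI[of _ n]) (auto simp: one_P_Sigma_apply)
      then show "P \<phi>" using one by simp
    qed
  qed
  moreover have "\<forall>i. \<exists>w. i \<in> {1..n} \<longrightarrow> w \<in> carrier (free_group n) \<and> \<phi> (gen i) = conj_word i w"
    using P_SigmaD(2)[OF assms(1)] by blast
  then have "\<exists>w. \<forall>i. i \<in> {1..n} \<longrightarrow> w i \<in> carrier (free_group n) \<and> \<phi> (gen i) = conj_word i (w i)"
    by (rule choice)
  ultimately show ?thesis using assms(1) by blast
qed

section \<open>Magnus coefficients of basis-conjugating automorphisms\<close>

definition coord :: "nat \<Rightarrow> nat \<Rightarrow> (word \<Rightarrow> word) \<Rightarrow> 'k::comm_ring_1" where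
  "coord p q \<phi> = magnus [p, q] (\<phi> (gen p))"

text \<open>
  This coefficient serves instead of the coefficient of \<open>X\<^sub>j X\<^sub>k\<close> in the conjugator of \<open>x\<^sub>p\<close>, since
  its definition involves no choice of a conjugator.
\<close>

definition coord3 :: "nat \<Rightarrow> nat \<Rightarrow> nat \<Rightarrow> (word \<Rightarrow> word) \<Rightarrow> 'k::comm_ring_1" where
  "coord3 p j k \<phi> = magnus [p, j, k] (\<phi> (gen p))"

lemma coord_conj_word:
  assumes "\<phi> (gen p) = conj_word p u" "p \<noteq> q"
  shows "coord p q \<phi> = magnus [q] u"
  using assms by (simp add: coord_def magnus_conj_word2)

text \<open>Generators go to conjugates of themselves, so the automorphism is trivial on the
  abelianization of the free group.\<close>

lemma magnus1_P_Sigma: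
  assumes \<phi>: "\<phi> \<in> carrier (P_Sigma n)" and w: "w \<in> carrier (free_group n)"
  shows "(magnus [j] (\<phi> w) :: 'k::comm_ring_1) = magnus [j] w"
  using w
proof (induction w)
  case Nil
  then show ?case by (simp add: hom_free_group_Nil[OF P_SigmaD(1)[OF \<phi>]])
next
  case (Cons x w)
  then have w: "w \<in> carrier (free_group n)" and x: "fst x \<in> {1..n}"
    by (auto simp: carrier_free_group reduced_word_Cons)
  obtain u where u: "\<phi> (gen (fst x)) = conj_word (fst x) u"
    using P_SigmaD(2)[OF \<phi> x] by blast
  define v where "v = \<phi> (gen (fst x))"
  have "(magnus [j] v :: 'k) = (if j = fst x then 1 else 0)"
    by (simp only: v_def u magnus_conj_word1)
  then have "(magnus [j] (\<phi> [x]) :: 'k) = magnus [j] [x]"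
    unfolding hom_free_group_letter[OF P_SigmaD(1)[OF \<phi>] x] v_def[symmetric]
    by (auto simp: magnus_word_inv1 letter_sign_def)
  then show ?case
    using Cons.IH[OF w]
    by (simp add: hom_free_group_Cons[OF P_SigmaD(1)[OF \<phi>] Cons.prems] magnus_foldr_push magnus_append1)
qed

text \<open>To second order, conjugating x_j by u adds the commutator of X_j with the linear part of
  u. So, up to the sign of the letter, each x_j in \<open>w\<close> contributes
  \<open>coord j k \<phi>\<close> to X_j X_k, and each x_k contributes the negative of
  \<open>coord k j \<phi>\<close>.\<close>

lemma magnus2_P_Sigma:
  assumes \<phi>: "\<phi> \<in> carrier (P_Sigma n)" and w: "w \<in> carrier (free_group n)" and jk: "j \<noteq> k"
  shows "(magnus [j, k] (\<phi> w) :: 'k::comm_ring_1)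
    = magnus [j, k] w + magnus [j] w * coord j k \<phi> - magnus [k] w * coord k j \<phi>"
  using w
proof (induction w)
  case Nil
  then show ?case by (simp add: hom_free_group_Nil[OF P_SigmaD(1)[OF \<phi>]])
next
  case (Cons x w)
  then have w: "w \<in> carrier (free_group n)" and x: "fst x \<in> {1..n}"
    by (auto simp: carrier_free_group reduced_word_Cons)
  then have x1: "[x] \<in> carrier (free_group n)" using letter_closed by blast
  obtain u where u: "\<phi> (gen (fst x)) = conj_word (fst x) u"
    using P_SigmaD(2)[OF \<phi> x] by blast
  define v where "v = \<phi> (gen (fst x))"
  have v: "(magnus [j, k] v :: 'k)
      = (if fst x = j then coord j k \<phi> else 0) - (if fst x = k then coord k j \<phi> else 0)"
    using jk u by (auto simp: v_def magnus_conj_word2 coord_conj_word)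
  \<comment> \<open>Inversion exchanges j and k, and the second order coefficients of a conjugate of
    a generator are antisymmetric in them.\<close>
  have "(magnus [j, k] (word_inv v) :: 'k) = - magnus [j, k] v"
    using jk by (auto simp: v_def u magnus_word_inv2 magnus_conj_word2)
  then have m2: "(magnus [j, k] (\<phi> [x]) :: 'k)
      = (if fst x = j then letter_sign x * coord j k \<phi> else 0)
        - (if fst x = k then letter_sign x * coord k j \<phi> else 0)"
    unfolding hom_free_group_letter[OF P_SigmaD(1)[OF \<phi>] x] v_def[symmetric]
    using jk by (auto simp: v letter_sign_def)
  have m1: "(magnus [j] (\<phi> [x]) :: 'k) = magnus [j] [x]" "(magnus [k] (\<phi> w) :: 'k) = magnus [k] w"
    using magnus1_P_Sigma[OF \<phi>] x1 w by blast+
  show ?case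
    using jk by (simp add: hom_free_group_Cons[OF P_SigmaD(1)[OF \<phi>] Cons.prems] magnus_foldr_push
        magnus_append2 m1 m2 Cons.IH[OF w] algebra_simps)
qed

context
  fixes n :: nat and \<phi> \<psi> :: "word \<Rightarrow> word"
  assumes \<phi>: "\<phi> \<in> carrier (P_Sigma n)" and \<psi>: "\<psi> \<in> carrier (P_Sigma n)"
begin

lemma mult_P_Sigma_conjugators:
  assumes "p \<in> {1..n}"
  obtains u w where "\<phi> (gen p) = conj_word p u" "\<psi> (gen p) = conj_word p w"
    "w \<in> carrier (free_group n)"
    "(\<phi> \<otimes>\<^bsub>P_Sigma n\<^esub> \<psi>) (gen p) = conj_word p (foldr push u (\<phi> w))"
  using P_SigmaD(2)[OF \<phi> assms] P_SigmaD(2)[OF \<psi> assms] mult_P_Sigma_gen[OF \<phi> \<psi> assms] by metis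

lemma coord_mult:
  assumes "p \<in> {1..n}" "p \<noteq> q"
  shows "(coord p q (\<phi> \<otimes>\<^bsub>P_Sigma n\<^esub> \<psi>) :: 'k::comm_ring_1) = coord p q \<phi> + coord p q \<psi>"
proof -
  obtain u w where "\<phi> (gen p) = conj_word p u" "\<psi> (gen p) = conj_word p w"
    "w \<in> carrier (free_group n)"
    "(\<phi> \<otimes>\<^bsub>P_Sigma n\<^esub> \<psi>) (gen p) = conj_word p (foldr push u (\<phi> w))"
    using mult_P_Sigma_conjugators[OF assms(1)] by metis
  then show ?thesis
    using assms magnus1_P_Sigma[OF \<phi>, of w q, where 'k = 'k]
    by (simp add: coord_conj_word magnus_foldr_push magnus_append1)
qed

text \<open>This is the coefficient of X_j X_k in the conjugator u \<phi>(w). Splitting it between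
  the factors gives \<open>coord p j \<phi> * coord p k \<psi>\<close>; the action of \<phi> on w
  gives the other two products.\<close>

lemma coord3_mult:
  assumes "p \<in> {1..n}" "distinct [p, j, k]"
  shows "(coord3 p j k (\<phi> \<otimes>\<^bsub>P_Sigma n\<^esub> \<psi>) :: 'k::comm_ring_1)
    = coord3 p j k \<phi> + coord3 p j k \<psi> + coord j k \<phi> * coord p j \<psi> - coord k j \<phi> * coord p k \<psi>
      + coord p j \<phi> * coord p k \<psi>"
proof -
  obtain u w where "\<phi> (gen p) = conj_word p u" "\<psi> (gen p) = conj_word p w"
    "w \<in> carrier (free_group n)"
    "(\<phi> \<otimes>\<^bsub>P_Sigma n\<^esub> \<psi>) (gen p) = conj_word p (foldr push u (\<phi> w))"
    using mult_P_Sigma_conjugators[OF assms(1)] by metis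
  then show ?thesis
    using assms magnus1_P_Sigma[OF \<phi>, of w k, where 'k = 'k]
      magnus2_P_Sigma[OF \<phi>, of w j k, where 'k = 'k]
    by (simp add: coord_conj_word coord3_def magnus_conj_word3 magnus_foldr_push magnus_append2
        algebra_simps)
qed

text \<open>The exponent sum of x_p in the conjugator w depends on the choice of w. It enters
  through the splitting and through the action of \<phi>, with opposite signs, and cancels. The 2 is
  the factor in \<open>magnus_conj_word3\<close>.\<close>

lemma coord3_mult':
  assumes "p \<in> {1..n}" "p \<noteq> j"
  shows "(coord3 p j p (\<phi> \<otimes>\<^bsub>P_Sigma n\<^esub> \<psi>) :: 'k::comm_ring_1)
    = coord3 p j p \<phi> + coord3 p j p \<psi> + 2 * (coord j p \<phi> * coord p j \<psi>)"
proof -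
  obtain u w where "\<phi> (gen p) = conj_word p u" "\<psi> (gen p) = conj_word p w"
    "w \<in> carrier (free_group n)"
    "(\<phi> \<otimes>\<^bsub>P_Sigma n\<^esub> \<psi>) (gen p) = conj_word p (foldr push u (\<phi> w))"
    using mult_P_Sigma_conjugators[OF assms(1)] by metis
  then show ?thesis
    using assms magnus1_P_Sigma[OF \<phi>, of w p, where 'k = 'k]
      magnus2_P_Sigma[OF \<phi>, of w j p, where 'k = 'k]
    by (simp add: coord_conj_word coord3_def magnus_conj_word3 magnus_foldr_push magnus_append2
        algebra_simps)
qed

end

lemma coord_beta:
  assumes "r \<in> {1..n}" "s \<in> {1..n}" "r \<noteq> s" "p \<in> {1..n}" "p \<noteq> q"
  shows "coord p q (beta n r s) = (if r = p \<and> s = q then 1 else 0)"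
proof -
  have "beta n r s (gen p) = conj_word p (if p = r then [(s, True)] else [])"
    using assms by (simp add: beta_eq_twist twist_gen)
  then show ?thesis using assms(5) by (auto simp: coord_conj_word)
qed


section \<open>The first resonance variety in terms of cochains\<close>

text \<open>
  For homomorphisms \<open>u\<close> and \<open>v\<close> into the field, \<open>m x y = u x * v y\<close> represents their cup product, and
  \<open>cup_exact G m\<close> says that it is a coboundary.
\<close>

definition cup_exact :: "('g, 'x) monoid_scheme \<Rightarrow> ('g \<Rightarrow> 'g \<Rightarrow> 'k::field) \<Rightarrow> bool" where
  "cup_exact G m \<longleftrightarrow> (\<exists>h. \<forall>x\<in>carrier G. \<forall>y\<in>carrier G. m x y = h x + h y - h (x \<otimes>\<^bsub>G\<^esub> y))"

abbreviation cocycles1 :: "('g, 'x) monoid_scheme \<Rightarrow> ('g list \<Rightarrow> 'k::field) set" where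
  "cocycles1 G \<equiv> cocycles (cochains G) (coboundary G) (Suc 0)"

section \<open>Cochains in degrees zero, one and two\<close>

lemma tuples_0: "gs \<in> tuples G 0 \<longleftrightarrow> gs = []"
  by (auto simp: tuples_def)

lemma tuples_1: "gs \<in> tuples G (Suc 0) \<longleftrightarrow> (\<exists>x\<in>carrier G. gs = [x])"
  by (cases gs) (auto simp: tuples_def)

lemma tuples_2: "gs \<in> tuples G (Suc (Suc 0)) \<longleftrightarrow> (\<exists>x\<in>carrier G. \<exists>y\<in>carrier G. gs = [x, y])"
  by (cases gs; cases "tl gs") (auto simp: tuples_def)

lemma coboundary_0: "coboundary G 0 f = (\<lambda>gs. 0)"
  by (rule ext) (auto simp: coboundary_def tuples_1)

lemma coboundary_1:
  "coboundary G (Suc 0) f gs = (if gs \<in> tuples G (Suc (Suc 0))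
    then f [gs ! 1] - f [gs ! 0 \<otimes>\<^bsub>G\<^esub> gs ! 1] + f [gs ! 0] else 0)"
  by (auto simp: coboundary_def tuples_2)

lemma cocycles1_iff:
  "f \<in> cocycles1 G \<longleftrightarrow> (\<forall>gs. gs \<notin> tuples G (Suc 0) \<longrightarrow> f gs = 0)
    \<and> (\<forall>x\<in>carrier G. \<forall>y\<in>carrier G. f [x \<otimes>\<^bsub>G\<^esub> y] = f [x] + f [y])"
proof -
  have "coboundary G (Suc 0) f = (\<lambda>gs. 0)
      \<longleftrightarrow> (\<forall>x\<in>carrier G. \<forall>y\<in>carrier G. f [x \<otimes>\<^bsub>G\<^esub> y] = f [x] + f [y])"
  proof
    assume 0: "coboundary G (Suc 0) f = (\<lambda>gs. 0)"
    show "\<forall>x\<in>carrier G. \<forall>y\<in>carrier G. f [x \<otimes>\<^bsub>G\<^esub> y] = f [x] + f [y]"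
    proof (intro ballI)
      fix x y assume "x \<in> carrier G" "y \<in> carrier G"
      then show "f [x \<otimes>\<^bsub>G\<^esub> y] = f [x] + f [y]"
        using fun_cong[OF 0, of "[x, y]"] by (simp add: coboundary_1 tuples_2 algebra_simps)
    qed
  qed (auto simp: fun_eq_iff coboundary_1 tuples_2)
  then show ?thesis by (simp add: cocycles_def cochains_def)
qed

text \<open>With trivial coefficients the first differential vanishes. Hence each class of degree
  one is a singleton \<open>{f}\<close>, and computations with classes become computations with
  homomorphisms.\<close>

lemma coboundaries_1: "coboundaries (cochains G) (coboundary G) (Suc 0) = {\<lambda>gs. 0}"
  by (auto simp: coboundaries_def coboundary_0 cochains_def)

lemma cocycles1_lincomb:
  assumes "f \<in> cocycles1 G" "g \<in> cocycles1 G"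
  shows "(\<lambda>gs. c * f gs + d * g gs) \<in> cocycles1 G"
  using assms by (simp add: cocycles1_iff algebra_simps)

lemma cocycles1_zero: "(\<lambda>gs. 0) \<in> cocycles1 G"
  by (simp add: cocycles1_iff)

lemma add_coset_eq: "H +>\<^bsub>M\<^esub> x = (\<lambda>h. h \<oplus>\<^bsub>M\<^esub> x) ` H"
  by (auto simp: a_r_coset_def r_coset_def)

lemma add_cosets_eq: "a_rcosets\<^bsub>M\<^esub> H = (\<lambda>x. H +>\<^bsub>M\<^esub> x) ` carrier M"
  by (auto simp: A_RCOSETS_def RCOSETS_def a_r_coset_def)

lemma
  fixes G :: "('g, 'x) monoid_scheme"
  defines "H \<equiv> (group_cohomology G (Suc 0) :: ('k::field, ('g list \<Rightarrow> 'k) set) module)"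
  shows carrier_H1: "carrier H = (\<lambda>f. {f}) ` cocycles1 G"
    and zero_H1: "\<zero>\<^bsub>H\<^esub> = {\<lambda>gs. 0}"
    and add_H1: "{f} \<oplus>\<^bsub>H\<^esub> {g} = {\<lambda>gs. f gs + g gs}"
    and smult_H1: "c \<odot>\<^bsub>H\<^esub> {f} = {\<lambda>gs. c * f gs}"
  unfolding H_def group_cohomology_def cohomology_def quotient_module_def
  by (auto simp: add_cosets_eq add_coset_eq coboundaries_1 set_add_def set_mult_def cochains_def)

lemma inv_H1:
  fixes f :: "'g list \<Rightarrow> 'k::field"
  assumes "f \<in> cocycles1 G"
  shows "\<ominus>\<^bsub>group_cohomology G (Suc 0)\<^esub> {f} = {\<lambda>gs. - f gs}"
  unfolding a_inv_def m_inv_def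
proof (rule the_equality)
  have "(\<lambda>gs. - f gs) \<in> cocycles1 G"
    using cocycles1_lincomb[OF assms assms, of "-1" 0] by simp
  then show "{\<lambda>gs. - f gs} \<in> carrier (add_monoid (group_cohomology G (Suc 0)))
    \<and> {f} \<otimes>\<^bsub>add_monoid (group_cohomology G (Suc 0))\<^esub> {\<lambda>gs. - f gs}
      = \<one>\<^bsub>add_monoid (group_cohomology G (Suc 0))\<^esub>
    \<and> {\<lambda>gs. - f gs} \<otimes>\<^bsub>add_monoid (group_cohomology G (Suc 0))\<^esub> {f}
      = \<one>\<^bsub>add_monoid (group_cohomology G (Suc 0))\<^esub>"
    by (simp add: carrier_H1 zero_H1 add_H1)
  fix X
  assume X: "X \<in> carrier (add_monoid (group_cohomology G (Suc 0)))
    \<and> {f} \<otimes>\<^bsub>add_monoid (group_cohomology G (Suc 0))\<^esub> X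
      = \<one>\<^bsub>add_monoid (group_cohomology G (Suc 0))\<^esub>
    \<and> X \<otimes>\<^bsub>add_monoid (group_cohomology G (Suc 0))\<^esub> {f}
      = \<one>\<^bsub>add_monoid (group_cohomology G (Suc 0))\<^esub>"
  then obtain g where g: "X = {g}" by (auto simp: carrier_H1)
  then have "(\<lambda>gs. f gs + g gs) = (\<lambda>gs. 0)"
    using X by (simp add: zero_H1 add_H1)
  then have "g gs = - f gs" for gs
    by (simp add: fun_eq_iff eq_neg_iff_add_eq_0 add.commute)
  then show "X = {\<lambda>gs. - f gs}" using g by auto
qed

lemma minus_H1:
  assumes "f \<in> cocycles1 G" "g \<in> cocycles1 G"
  shows "{f} \<ominus>\<^bsub>group_cohomology G (Suc 0)\<^esub> {g} = {\<lambda>gs. f gs - g gs}"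
  using assms by (simp add: a_minus_def inv_H1 add_H1)

text \<open>Three generators serve both kinds of span in the theorem; for a span of two classes the
  last one is repeated.\<close>

lemma lin_span_H1:
  fixes u v w :: "'g list \<Rightarrow> 'k::field"
  assumes "u \<in> cocycles1 G" "v \<in> cocycles1 G" "w \<in> cocycles1 G"
  shows "lin_span (group_cohomology G (Suc 0)) {{u}, {v}, {w}}
    = {{\<lambda>gs. a * u gs + b * v gs + c * w gs} | a b c. True}" (is "?L = ?R")
proof
  let ?H = "group_cohomology G (Suc 0) :: ('k, ('g list \<Rightarrow> 'k) set) module"
  have comb: "(\<lambda>gs. a * u gs + b * v gs + c * w gs) \<in> cocycles1 G" for a b c
    using cocycles1_lincomb[OF cocycles1_lincomb[OF assms(1,2)] assms(3), of 1 a b c] by simp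
  have "submodule ?R scalar_ring ?H"
  proof (intro submodule.intro subgroup.intro submodule_axioms.intro)
    show "?R \<subseteq> carrier (add_monoid ?H)"
      using comb by (auto simp: carrier_H1)
    show "x \<otimes>\<^bsub>add_monoid ?H\<^esub> y \<in> ?R" if xy: "x \<in> ?R" "y \<in> ?R" for x y
    proof -
      obtain a b c a' b' c' where "x = {\<lambda>gs. a * u gs + b * v gs + c * w gs}"
        "y = {\<lambda>gs. a' * u gs + b' * v gs + c' * w gs}"
        using xy by auto
      then have "x \<otimes>\<^bsub>add_monoid ?H\<^esub> y
          = {\<lambda>gs. (a + a') * u gs + (b + b') * v gs + (c + c') * w gs}"
        by (simp add: add_H1 algebra_simps)
      then show ?thesis by blast
    qed
    show "\<one>\<^bsub>add_monoid ?H\<^esub> \<in> ?R"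
    proof -
      have "\<one>\<^bsub>add_monoid ?H\<^esub> = {\<lambda>gs. 0 * u gs + 0 * v gs + 0 * w gs}"
        by (simp add: zero_H1)
      then show ?thesis by blast
    qed
    show "inv\<^bsub>add_monoid ?H\<^esub> x \<in> ?R" if xR: "x \<in> ?R" for x
    proof -
      obtain a b c where x: "x = {\<lambda>gs. a * u gs + b * v gs + c * w gs}" using xR by auto
      have "inv\<^bsub>add_monoid ?H\<^esub> x = {\<lambda>gs. (- a) * u gs + (- b) * v gs + (- c) * w gs}"
        using inv_H1[OF comb, of a b c] by (simp add: x a_inv_def algebra_simps)
      then show ?thesis by blast
    qed
    show "d \<odot>\<^bsub>?H\<^esub> x \<in> ?R" if xR: "x \<in> ?R" for d x
    proof -
      obtain a b c where x: "x = {\<lambda>gs. a * u gs + b * v gs + c * w gs}" using xR by auto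
      have "d \<odot>\<^bsub>?H\<^esub> x = {\<lambda>gs. (d * a) * u gs + (d * b) * v gs + (d * c) * w gs}"
        by (simp add: x smult_H1 algebra_simps)
      then show ?thesis by blast
    qed
  qed
  moreover have "{{u}, {v}, {w}} \<subseteq> ?R"
  proof -
    have "{u} = {\<lambda>gs. 1 * u gs + 0 * v gs + 0 * w gs}"
      "{v} = {\<lambda>gs. 0 * u gs + 1 * v gs + 0 * w gs}"
      "{w} = {\<lambda>gs. 0 * u gs + 0 * v gs + 1 * w gs}" by auto
    then show ?thesis by blast
  qed
  ultimately show "?L \<subseteq> ?R" unfolding lin_span_def by blast
  show "?R \<subseteq> ?L"
  proof
    fix x assume "x \<in> ?R"
    then obtain a b c where x: "x = {\<lambda>gs. a * u gs + b * v gs + c * w gs}" by auto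
    show "x \<in> ?L"
      unfolding lin_span_def
    proof (rule InterI)
      fix K assume K: "K \<in> {K. submodule K scalar_ring ?H \<and> {{u}, {v}, {w}} \<subseteq> K}"
      then interpret submodule K scalar_ring ?H by blast
      have "a \<odot>\<^bsub>?H\<^esub> {u} \<in> K" "b \<odot>\<^bsub>?H\<^esub> {v} \<in> K" "c \<odot>\<^bsub>?H\<^esub> {w} \<in> K"
        using K by (auto intro!: smult_closed simp: scalar_ring_def)
      then have "(a \<odot>\<^bsub>?H\<^esub> {u} \<oplus>\<^bsub>?H\<^esub> b \<odot>\<^bsub>?H\<^esub> {v}) \<oplus>\<^bsub>?H\<^esub> c \<odot>\<^bsub>?H\<^esub> {w} \<in> K"
        using m_closed by simp
      then show "x \<in> K" by (simp add: x smult_H1 add_H1)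
    qed
  qed
qed

text \<open>The product of the classes is the coset of the cup product cochain modulo the
  coboundaries \<open>?B\<close>, and the zero class is \<open>?B\<close> itself; they agree iff the
  cochain lies in \<open>?B\<close>.\<close>

lemma gmult_1_1_eq_zero_iff:
  fixes f g :: "'g list \<Rightarrow> 'k::field"
  assumes closed: "\<And>x y. \<lbrakk>x \<in> carrier G; y \<in> carrier G\<rbrakk> \<Longrightarrow> x \<otimes>\<^bsub>G\<^esub> y \<in> carrier G"
  shows "gmult (cohomology_ring G) (Suc 0) (Suc 0) {f} {g} = \<zero>\<^bsub>group_cohomology G (Suc (Suc 0))\<^esub>
    \<longleftrightarrow> cup_exact G (\<lambda>x y. f [x] * g [y])"
proof -
  let ?B = "coboundary G (Suc 0) ` carrier (cochains G (Suc 0)) :: ('g list \<Rightarrow> 'k) set"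
  have B: "coboundaries (cochains G) (coboundary G) (Suc (Suc 0)) = ?B"
    by (simp add: coboundaries_def numeral_2_eq_2)
  have add: "(\<lambda>gs. coboundary G (Suc 0) h gs + coboundary G (Suc 0) h' gs) = coboundary G (Suc 0) (\<lambda>gs. h gs + h' gs)"
    and diff: "(\<lambda>gs. coboundary G (Suc 0) h gs - coboundary G (Suc 0) h' gs) = coboundary G (Suc 0) (\<lambda>gs. h gs - h' gs)"
    for h h' :: "'g list \<Rightarrow> 'k"
    by (auto simp: coboundary_1)
  let ?c = "cup G (Suc 0) (Suc 0) f g"
  have "gmult (cohomology_ring G) (Suc 0) (Suc 0) {f} {g} = (\<lambda>h gs. h gs + ?c gs) ` ?B"
    using B by (simp add: cohomology_ring_def add_coset_eq cochains_def numeral_2_eq_2)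
  moreover have "\<zero>\<^bsub>group_cohomology G (Suc (Suc 0))\<^esub> = ?B"
    using B by (simp add: group_cohomology_def cohomology_def quotient_module_def)
  moreover have "(\<lambda>h gs. h gs + ?c gs) ` ?B = ?B \<longleftrightarrow> ?c \<in> ?B"
  proof
    have "(\<lambda>gs. 0) \<in> ?B"
      by (rule image_eqI[of _ _ "\<lambda>gs. 0"]) (auto simp: coboundary_1 cochains_def)
    then have "?c \<in> (\<lambda>h gs. h gs + ?c gs) ` ?B" by force
    then show "(\<lambda>h gs. h gs + ?c gs) ` ?B = ?B \<Longrightarrow> ?c \<in> ?B" by simp
  next
    assume "?c \<in> ?B"
    then obtain h where h: "h \<in> carrier (cochains G (Suc 0))" "?c = coboundary G (Suc 0) h" by blast
    show "(\<lambda>h gs. h gs + ?c gs) ` ?B = ?B"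
    proof (intro equalityI subsetI)
      fix k assume "k \<in> (\<lambda>h gs. h gs + ?c gs) ` ?B"
      then obtain h' where "h' \<in> carrier (cochains G (Suc 0))"
        "k = (\<lambda>gs. coboundary G (Suc 0) h' gs + coboundary G (Suc 0) h gs)" using h by auto
      then show "k \<in> ?B" using h(1) unfolding add
        by (intro image_eqI[of k _ "\<lambda>gs. h' gs + h gs"]) (auto simp: cochains_def)
    next
      fix k assume "k \<in> ?B"
      then obtain h' where h': "h' \<in> carrier (cochains G (Suc 0))" "k = coboundary G (Suc 0) h'" by blast
      have "k = (\<lambda>gs. coboundary G (Suc 0) (\<lambda>gs. h' gs - h gs) gs + ?c gs)"
        unfolding h h' diff[symmetric] by simp
      moreover have "coboundary G (Suc 0) (\<lambda>gs. h' gs - h gs) \<in> ?B"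
        using h h' by (intro imageI) (auto simp: cochains_def)
      ultimately show "k \<in> (\<lambda>h gs. h gs + ?c gs) ` ?B" by blast
    qed
  qed
  moreover have "?c \<in> ?B \<longleftrightarrow> cup_exact G (\<lambda>x y. f [x] * g [y])"
  proof
    assume "?c \<in> ?B"
    then obtain h where h: "?c = coboundary G (Suc 0) h" by blast
    have "f [x] * g [y] = h [x] + h [y] - h [x \<otimes>\<^bsub>G\<^esub> y]" if "x \<in> carrier G" "y \<in> carrier G" for x y
      using fun_cong[OF h, of "[x, y]"] that by (simp add: cup_def coboundary_1 tuples_2)
    then show "cup_exact G (\<lambda>x y. f [x] * g [y])"
      unfolding cup_exact_def by (intro exI[of _ "\<lambda>x. h [x]"]) blast
  next
    assume "cup_exact G (\<lambda>x y. f [x] * g [y])"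
    then obtain h where h: "\<And>x y. \<lbrakk>x \<in> carrier G; y \<in> carrier G\<rbrakk>
        \<Longrightarrow> f [x] * g [y] = h x + h y - h (x \<otimes>\<^bsub>G\<^esub> y)"
      unfolding cup_exact_def by blast
    let ?h = "\<lambda>gs. if gs \<in> tuples G (Suc 0) then h (hd gs) else 0"
    have "?c = coboundary G (Suc 0) ?h"
    proof
      fix gs
      show "?c gs = coboundary G (Suc 0) ?h gs"
        using closed h by (auto simp: cup_def coboundary_1 tuples_2 tuples_1)
    qed
    then show "?c \<in> ?B" by (intro image_eqI[of _ _ ?h]) (auto simp: cochains_def)
  qed
  ultimately show ?thesis by simp
qed

text \<open>In degree zero the cohomology consists of the constants, so left multiplication by
  \<open>{f}\<close> has as image the multiples of f. The complex has cohomology in degree one iff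
  some g with exact product is not such a multiple; for f = 0 this asks for a nonzero g.\<close>

lemma first_resonance_cohomology_ring:
  fixes G :: "('g, 'x) monoid_scheme"
  assumes closed: "\<And>x y. \<lbrakk>x \<in> carrier G; y \<in> carrier G\<rbrakk> \<Longrightarrow> x \<otimes>\<^bsub>G\<^esub> y \<in> carrier G"
  shows "first_resonance (cohomology_ring G :: ('k::field, ('g list \<Rightarrow> 'k) set) graded_algebra)
    = {{f} | f. f \<in> cocycles1 G \<and> (\<exists>g\<in>cocycles1 G. cup_exact G (\<lambda>x y. f [x] * g [y])
        \<and> (\<forall>c. g \<noteq> (\<lambda>gs. c * f gs)))}"
proof -
  let ?A = "cohomology_ring G :: ('k, ('g list \<Rightarrow> 'k) set) graded_algebra"
  have component: "component ?A = group_cohomology G" by (simp add: cohomology_ring_def)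
  have nontrivial: "carrier (cohomology (component ?A) (left_mult ?A {f}) (Suc 0))
        \<noteq> {\<zero>\<^bsub>cohomology (component ?A) (left_mult ?A {f}) (Suc 0)\<^esub>}
      \<longleftrightarrow> (\<exists>g\<in>cocycles1 G. cup_exact G (\<lambda>x y. f [x] * g [y]) \<and> (\<forall>c. g \<noteq> (\<lambda>gs. c * f gs)))"
    if f: "f \<in> cocycles1 G" for f :: "'g list \<Rightarrow> 'k"
  proof -
    let ?Z = "cocycles (component ?A) (left_mult ?A {f}) (Suc 0)"
    let ?B = "coboundaries (component ?A) (left_mult ?A {f}) (Suc 0)"
    have Z: "?Z = (\<lambda>g. {g}) ` {g \<in> cocycles1 G. cup_exact G (\<lambda>x y. f [x] * g [y])}"
      using gmult_1_1_eq_zero_iff[OF closed, of f]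
      unfolding component cocycles_def[of "group_cohomology G"] by (auto simp: carrier_H1 left_mult_def)
    have H0: "carrier (group_cohomology G 0 :: ('k, ('g list \<Rightarrow> 'k) set) module)
        = range (\<lambda>c. {\<lambda>gs. if gs = [] then c else 0})"
    proof -
      have c0: "carrier (cochains G 0) = range (\<lambda>c::'k. \<lambda>gs. if gs = [] then c else 0)"
      proof (intro equalityI subsetI)
        fix h :: "'g list \<Rightarrow> 'k" assume "h \<in> carrier (cochains G 0)"
        then have "h = (\<lambda>gs. if gs = [] then h [] else 0)"
          by (auto simp: cochains_def tuples_0)
        then show "h \<in> range (\<lambda>c gs. if gs = [] then c else 0)" by blast
      qed (auto simp: cochains_def tuples_0)
      have "cocycles (cochains G) (coboundary G) 0 = range (\<lambda>c::'k. \<lambda>gs. if gs = [] then c else 0)"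
        by (simp add: cocycles_def c0 coboundary_0) (simp add: cochains_def)
      then show ?thesis
        by (simp add: group_cohomology_def cohomology_def quotient_module_def add_cosets_eq add_coset_eq
            coboundaries_def image_image) (simp add: cochains_def)
    qed
    have cup0: "cup G (Suc 0) 0 f (\<lambda>gs. if gs = [] then c else 0) = (\<lambda>gs. c * f gs)" for c
      using f by (intro ext) (auto simp: cup_def cocycles1_iff tuples_1)
    have "?B = left_mult ?A {f} 0 ` range (\<lambda>c. {\<lambda>gs. if gs = [] then c else 0})"
      by (simp add: coboundaries_def component H0)
    also have "\<dots> = range (\<lambda>c. {\<lambda>gs. c * f gs})"
      using cup0 by (simp add: image_image left_mult_def cohomology_ring_def coboundaries_1 add_coset_eq)
        (simp add: cochains_def)
    finally have B: "?B = range (\<lambda>c. {\<lambda>gs. c * f gs})" .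
    let ?M = "(component ?A (Suc 0))\<lparr>carrier := ?Z\<rparr>"
    have coset: "?B +>\<^bsub>?M\<^esub> {g} = range (\<lambda>c. {\<lambda>gs. c * f gs + g gs})" for g
      unfolding add_coset_eq B by (simp add: image_image component add_H1)
    have coset_eq: "?B +>\<^bsub>?M\<^esub> {g} = ?B \<longleftrightarrow> (\<exists>c. g = (\<lambda>gs. c * f gs))" for g
    proof
      assume "?B +>\<^bsub>?M\<^esub> {g} = ?B"
      then have "{\<lambda>gs. 0 * f gs + g gs} \<in> ?B" unfolding coset by blast
      then show "\<exists>c. g = (\<lambda>gs. c * f gs)" by (auto simp: B)
    next
      assume "\<exists>c. g = (\<lambda>gs. c * f gs)"
      then obtain d where d: "g = (\<lambda>gs. d * f gs)" by blast
      have "range (\<lambda>c. {\<lambda>gs. c * f gs + d * f gs}) = range (\<lambda>c. {\<lambda>gs. c * f gs})"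
      proof (intro equalityI subsetI)
        fix x assume "x \<in> range (\<lambda>c. {\<lambda>gs. c * f gs + d * f gs})"
        then obtain c where "x = {\<lambda>gs. (c + d) * f gs}" by (auto simp: algebra_simps)
        then show "x \<in> range (\<lambda>c. {\<lambda>gs. c * f gs})" by blast
      next
        fix x assume "x \<in> range (\<lambda>c. {\<lambda>gs. c * f gs})"
        then obtain c where "x = {\<lambda>gs. (c - d) * f gs + d * f gs}" by (auto simp: algebra_simps)
        then show "x \<in> range (\<lambda>c. {\<lambda>gs. c * f gs + d * f gs})" by blast
      qed
      then show "?B +>\<^bsub>?M\<^esub> {g} = ?B" by (subst coset) (simp only: d B)
    qed
    have mem: "X \<in> ?Z \<longleftrightarrow> (\<exists>g\<in>cocycles1 G. X = {g} \<and> cup_exact G (\<lambda>x y. f [x] * g [y]))" for X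
      unfolding Z by blast
    have "cup_exact G (\<lambda>x y. f [x] * 0)"
      unfolding cup_exact_def by (intro exI[of _ "\<lambda>x. 0"]) simp
    then have zero: "{\<lambda>gs. 0} \<in> ?Z"
      unfolding mem using cocycles1_zero by blast
    \<comment> \<open>The image of an empty set would also differ from \<open>{b}\<close>; the zero
      class rules this out.\<close>
    have image: "\<phi> ` Y \<noteq> {b} \<longleftrightarrow> (\<exists>X\<in>Y. \<phi> X \<noteq> b)" if "x \<in> Y"
      for \<phi> :: "('g list \<Rightarrow> 'k) set \<Rightarrow> ('g list \<Rightarrow> 'k) set set" and Y b x
      using that by auto
    have "carrier (cohomology (component ?A) (left_mult ?A {f}) (Suc 0)) = (\<lambda>X. ?B +>\<^bsub>?M\<^esub> X) ` ?Z"
      "\<zero>\<^bsub>cohomology (component ?A) (left_mult ?A {f}) (Suc 0)\<^esub> = ?B"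
      by (simp_all add: cohomology_def quotient_module_def add_cosets_eq)
    then have "carrier (cohomology (component ?A) (left_mult ?A {f}) (Suc 0))
        \<noteq> {\<zero>\<^bsub>cohomology (component ?A) (left_mult ?A {f}) (Suc 0)\<^esub>}
      \<longleftrightarrow> (\<exists>X\<in>?Z. ?B +>\<^bsub>?M\<^esub> X \<noteq> ?B)"
      using image[OF zero] by (simp only:)
    also have "\<dots> \<longleftrightarrow> (\<exists>g\<in>cocycles1 G. cup_exact G (\<lambda>x y. f [x] * g [y]) \<and> (\<forall>c. g \<noteq> (\<lambda>gs. c * f gs)))"
    proof
      assume "\<exists>X\<in>?Z. ?B +>\<^bsub>?M\<^esub> X \<noteq> ?B"
      then obtain X where X: "X \<in> ?Z" "?B +>\<^bsub>?M\<^esub> X \<noteq> ?B" ..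
      then obtain g where "g \<in> cocycles1 G" "X = {g}" "cup_exact G (\<lambda>x y. f [x] * g [y])"
        unfolding mem by blast
      then show "\<exists>g\<in>cocycles1 G. cup_exact G (\<lambda>x y. f [x] * g [y]) \<and> (\<forall>c. g \<noteq> (\<lambda>gs. c * f gs))"
        using X(2) coset_eq[of g] by blast
    next
      assume "\<exists>g\<in>cocycles1 G. cup_exact G (\<lambda>x y. f [x] * g [y]) \<and> (\<forall>c. g \<noteq> (\<lambda>gs. c * f gs))"
      then obtain g where g: "g \<in> cocycles1 G" "cup_exact G (\<lambda>x y. f [x] * g [y])"
        "\<forall>c. g \<noteq> (\<lambda>gs. c * f gs)" by blast
      then have "{g} \<in> ?Z" unfolding mem by blast
      moreover have "?B +>\<^bsub>?M\<^esub> {g} \<noteq> ?B" using coset_eq[of g] g(3) by blast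
      ultimately show "\<exists>X\<in>?Z. ?B +>\<^bsub>?M\<^esub> X \<noteq> ?B" ..
    qed
    finally show ?thesis .
  qed
  have *: "{X \<in> (\<lambda>f. {f}) ` Z. P X} = {{f} | f. f \<in> Z \<and> Q f}"
    if "\<And>f. f \<in> Z \<Longrightarrow> P {f} \<longleftrightarrow> Q f" for Z :: "'a set" and P Q
    using that by auto
  have "first_resonance ?A = {X \<in> (\<lambda>f. {f}) ` cocycles1 G.
      carrier (cohomology (component ?A) (left_mult ?A X) (Suc 0))
        \<noteq> {\<zero>\<^bsub>cohomology (component ?A) (left_mult ?A X) (Suc 0)\<^esub>}}"
    by (simp add: first_resonance_def component carrier_H1)
  also have "\<dots> = {{f} | f. f \<in> cocycles1 G \<and> (\<exists>g\<in>cocycles1 G. cup_exact G (\<lambda>x y. f [x] * g [y])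
        \<and> (\<forall>c. g \<noteq> (\<lambda>gs. c * f gs)))}"
    using nontrivial by (rule *)
  finally show ?thesis .
qed

section \<open>Exact cup products\<close>

lemma cup_exact_cong:
  assumes "cup_exact G m"
    and "\<And>x y. \<lbrakk>x \<in> carrier G; y \<in> carrier G\<rbrakk> \<Longrightarrow> m' x y = m x y"
  shows "cup_exact G m'"
  using assms unfolding cup_exact_def by metis

lemma cup_exact_lincomb:
  assumes "cup_exact G m" "cup_exact G m'"
  shows "cup_exact G (\<lambda>x y. a * m x y + b * m' x y)"
proof -
  obtain h where h: "\<And>x y. \<lbrakk>x \<in> carrier G; y \<in> carrier G\<rbrakk> \<Longrightarrow> m x y = h x + h y - h (x \<otimes>\<^bsub>G\<^esub> y)"
    using assms(1) unfolding cup_exact_def by blast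
  obtain h' where h': "\<And>x y. \<lbrakk>x \<in> carrier G; y \<in> carrier G\<rbrakk> \<Longrightarrow> m' x y = h' x + h' y - h' (x \<otimes>\<^bsub>G\<^esub> y)"
    using assms(2) unfolding cup_exact_def by blast
  show ?thesis
    unfolding cup_exact_def
    by (intro exI[of _ "\<lambda>x. a * h x + b * h' x"]) (simp add: h h' algebra_simps)
qed

text \<open>Graded commutativity in degree one: the pointwise product u v is quadratic, and its
  failure to be additive is the symmetrized product.\<close>

lemma cup_exact_symmetrized:
  assumes "\<And>x y. \<lbrakk>x \<in> carrier G; y \<in> carrier G\<rbrakk> \<Longrightarrow> u (x \<otimes>\<^bsub>G\<^esub> y) = u x + u y"
    "\<And>x y. \<lbrakk>x \<in> carrier G; y \<in> carrier G\<rbrakk> \<Longrightarrow> v (x \<otimes>\<^bsub>G\<^esub> y) = v x + v y"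
  shows "cup_exact G (\<lambda>x y. u x * v y + v x * u y)"
  unfolding cup_exact_def
  by (intro exI[of _ "\<lambda>x. - (u x * v x)"]) (simp add: assms algebra_simps)

lemma cup_exact_self:
  fixes u :: "'g \<Rightarrow> 'k::field_char_0"
  assumes "\<And>x y. \<lbrakk>x \<in> carrier G; y \<in> carrier G\<rbrakk> \<Longrightarrow> u (x \<otimes>\<^bsub>G\<^esub> y) = u x + u y"
  shows "cup_exact G (\<lambda>x y. u x * u y)"
  using cup_exact_lincomb[OF cup_exact_symmetrized[OF assms assms] cup_exact_symmetrized[OF assms assms], of "1/2" 0]
  by (rule cup_exact_cong) (auto simp: field_simps)

lemma cup_exact_swap:
  fixes u v :: "'g \<Rightarrow> 'k::field"
  assumes "\<And>x y. \<lbrakk>x \<in> carrier G; y \<in> carrier G\<rbrakk> \<Longrightarrow> u (x \<otimes>\<^bsub>G\<^esub> y) = u x + u y"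
    "\<And>x y. \<lbrakk>x \<in> carrier G; y \<in> carrier G\<rbrakk> \<Longrightarrow> v (x \<otimes>\<^bsub>G\<^esub> y) = v x + v y"
    and "cup_exact G (\<lambda>x y. u x * v y)"
  shows "cup_exact G (\<lambda>x y. v x * u y)"
  using cup_exact_lincomb[OF cup_exact_symmetrized[OF assms(1,2)] assms(3), of 1 "-1"]
  by (rule cup_exact_cong) (auto simp: algebra_simps)

text \<open>Pairwise exact products make the products of any combination f with u and with v exact.
  As u and v are independent, which the two tuples \<open>gs\<close> and \<open>gs'\<close> witness,
  they are not both multiples of f. This includes f = 0.\<close>

lemma first_resonance_contains_isotropic:
  fixes u v w :: "'g list \<Rightarrow> 'k::field_char_0"
  assumes closed: "\<And>x y. \<lbrakk>x \<in> carrier G; y \<in> carrier G\<rbrakk> \<Longrightarrow> x \<otimes>\<^bsub>G\<^esub> y \<in> carrier G"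
    and Z: "u \<in> cocycles1 G" "v \<in> cocycles1 G" "w \<in> cocycles1 G"
    and exact: "cup_exact G (\<lambda>x y. u [x] * v [y])" "cup_exact G (\<lambda>x y. u [x] * w [y])"
      "cup_exact G (\<lambda>x y. v [x] * w [y])"
    and indep: "u gs = 1" "v gs = 0" "u gs' = 0" "v gs' = 1"
  shows "{\<lambda>gs. a * u gs + b * v gs + c * w gs} \<in> first_resonance (cohomology_ring G)"
proof -
  let ?f = "\<lambda>gs. a * u gs + b * v gs + c * w gs"
  have add: "t [x \<otimes>\<^bsub>G\<^esub> y] = t [x] + t [y]" if "t \<in> cocycles1 G" "x \<in> carrier G" "y \<in> carrier G"
    for t :: "'g list \<Rightarrow> 'k" and x y
    using that by (simp add: cocycles1_iff)
  have swap: "cup_exact G (\<lambda>x y. s [x] * t [y]) \<Longrightarrow> cup_exact G (\<lambda>x y. t [x] * s [y])"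
    if "s \<in> cocycles1 G" "t \<in> cocycles1 G" for s t :: "'g list \<Rightarrow> 'k"
    using cup_exact_swap[of G "\<lambda>x. s [x]" "\<lambda>x. t [x]"] add that by blast
  have self: "cup_exact G (\<lambda>x y. t [x] * t [y])" if "t \<in> cocycles1 G" for t :: "'g list \<Rightarrow> 'k"
    using cup_exact_self[of G "\<lambda>x. t [x]"] add that by blast
  have f: "?f \<in> cocycles1 G"
    using cocycles1_lincomb[OF cocycles1_lincomb[OF Z(1,2)] Z(3), of 1 a b c] by simp
  have left: "cup_exact G (\<lambda>x y. ?f [x] * t [y])"
    if "cup_exact G (\<lambda>x y. u [x] * t [y])" "cup_exact G (\<lambda>x y. v [x] * t [y])"
      "cup_exact G (\<lambda>x y. w [x] * t [y])" for t :: "'g list \<Rightarrow> 'k"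
    using cup_exact_lincomb[OF cup_exact_lincomb[OF that(1,2), of a b] that(3), of 1 c]
    by (rule cup_exact_cong) (simp add: algebra_simps)
  have u: "cup_exact G (\<lambda>x y. ?f [x] * u [y])"
    using left[of u] self[OF Z(1)] swap[OF Z(1,2) exact(1)] swap[OF Z(1,3) exact(2)] by blast
  have v: "cup_exact G (\<lambda>x y. ?f [x] * v [y])"
    using left[of v] self[OF Z(2)] exact(1) swap[OF Z(2,3) exact(3)] by blast
  have "(\<forall>d. u \<noteq> (\<lambda>gs. d * ?f gs)) \<or> (\<forall>d. v \<noteq> (\<lambda>gs. d * ?f gs))"
  proof (rule ccontr)
    assume "\<not> ?thesis"
    then obtain d d' where "u = (\<lambda>gs. d * ?f gs)" "v = (\<lambda>gs. d' * ?f gs)" by blast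
    then have d: "u gs = d * ?f gs" "v gs = d' * ?f gs" for gs by (metis, metis)
    \<comment> \<open>At \<open>gs\<close>, u = 1 gives f \<noteq> 0 and then v = 0 gives d' = 0;
      but v = 1 at \<open>gs'\<close>.\<close>
    from d(1)[of gs] d(2)[of gs] d(1)[of gs'] d(2)[of gs'] show False
      unfolding indep by (metis mult_eq_0_iff mult_zero_left zero_neq_one)
  qed
  then have "\<exists>t\<in>cocycles1 G. cup_exact G (\<lambda>x y. ?f [x] * t [y]) \<and> (\<forall>d. t \<noteq> (\<lambda>gs. d * ?f gs))"
    using u v Z(1,2) by blast
  then show ?thesis
    using f by (simp only: first_resonance_cohomology_ring[OF closed]) blast
qed


section \<open>Classes in the first cohomology group\<close>

definition basis_cocycle :: "nat \<Rightarrow> nat \<Rightarrow> nat \<Rightarrow> (word \<Rightarrow> word) list \<Rightarrow> 'k::field" where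
  "basis_cocycle n p q gs = (if gs \<in> tuples (P_Sigma n) 1 then coord p q (hd gs) else 0)"

lemma basis_cocycle_apply: "\<phi> \<in> carrier (P_Sigma n) \<Longrightarrow> basis_cocycle n p q [\<phi>] = coord p q \<phi>"
  by (simp add: basis_cocycle_def tuples_1)

lemma basis_cocycle_closed:
  "\<lbrakk>p \<in> {1..n}; p \<noteq> q\<rbrakk> \<Longrightarrow> basis_cocycle n p q \<in> cocycles1 (P_Sigma n)"
  by (simp add: cocycles1_iff basis_cocycle_apply coord_mult mult_closed_P_Sigma del: atLeastAtMost_iff)
    (simp add: basis_cocycle_def)

lemma beta_closed:
  "\<lbrakk>p \<in> {1..n}; q \<in> {1..n}; p \<noteq> q\<rbrakk> \<Longrightarrow> beta n p q \<in> carrier (P_Sigma n)"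
  by (simp add: beta_eq_twist twist_closed)

lemma basis_cocycle_beta:
  assumes "r \<in> {1..n}" "s \<in> {1..n}" "r \<noteq> s" "p \<in> {1..n}" "p \<noteq> q"
  shows "basis_cocycle n p q [beta n r s] = (if r = p \<and> s = q then 1 else 0)"
  using coord_beta[OF assms] beta_closed[OF assms(1-3)] by (simp add: basis_cocycle_apply)

lemma cocycles1_diff:
  "\<lbrakk>f \<in> cocycles1 G; g \<in> cocycles1 G\<rbrakk> \<Longrightarrow> (\<lambda>gs. f gs - g gs) \<in> cocycles1 G"
  using cocycles1_lincomb[of f G g 1 "-1"] by simp

lemma cocycles1_P_Sigma_eqI:
  fixes f g :: "(word \<Rightarrow> word) list \<Rightarrow> 'k::field"
  assumes "f \<in> cocycles1 (P_Sigma n)" "g \<in> cocycles1 (P_Sigma n)"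
    and eq: "\<And>r s. \<lbrakk>r \<in> {1..n}; s \<in> {1..n}; r \<noteq> s\<rbrakk> \<Longrightarrow> f [beta n r s] = g [beta n r s]"
  shows "f = g"
proof -
  let ?d = "\<lambda>\<phi>. f [\<phi>] - g [\<phi>]"
  have add: "?d (\<phi> \<otimes>\<^bsub>P_Sigma n\<^esub> \<psi>) = ?d \<phi> + ?d \<psi>"
    if "\<phi> \<in> carrier (P_Sigma n)" "\<psi> \<in> carrier (P_Sigma n)" for \<phi> \<psi>
    using assms(1,2) that by (simp add: cocycles1_iff)
  \<comment> \<open>An additive map vanishes at the identity because 1 * 1 = 1.\<close>
  have "\<one>\<^bsub>P_Sigma n\<^esub> \<otimes>\<^bsub>P_Sigma n\<^esub> \<one>\<^bsub>P_Sigma n\<^esub> = \<one>\<^bsub>P_Sigma n\<^esub>"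
    using one_closed_P_Sigma[of n] mult_closed_P_Sigma[of _ n]
    by (intro P_Sigma_eqI[of _ n]) (auto simp: mult_P_Sigma_apply gen_closed one_P_Sigma_apply)
  then have at_one: "?d \<one>\<^bsub>P_Sigma n\<^esub> = 0"
    using add[OF one_closed_P_Sigma one_closed_P_Sigma] by simp
  have on_twist: "?d (twist n p x) = 0" if "p \<in> {1..n}" "fst x \<in> {1..n}" "fst x \<noteq> p" for p x
  proof (cases "snd x")
    case True
    then have "x = (fst x, True)" by (simp add: prod_eq_iff)
    then show ?thesis using eq[of p "fst x"] beta_eq_twist[of p n "fst x"] that by auto
  next
    case False
    then have "inv_letter x = (fst x, True)" by (simp add: inv_letter_def)
    then have "?d (twist n p (inv_letter x)) = 0"
      using eq[of p "fst x"] beta_eq_twist[of p n "fst x"] that by auto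
    moreover have "?d (twist n p x \<otimes>\<^bsub>P_Sigma n\<^esub> twist n p (inv_letter x)) = 0"
      using twist_mult_twist_inverse[OF that(2,3)] at_one by simp
    ultimately show ?thesis
      using add[OF twist_closed twist_closed, of x p "inv_letter x" p] that by simp
  qed
  have "?d \<phi> = 0" if "\<phi> \<in> carrier (P_Sigma n)" for \<phi>
    using that
  proof (induction rule: P_Sigma_induct)
    case one
    show ?case by (rule at_one)
  next
    case (twist \<phi> p x)
    then show ?case
      using add[OF twist(1) twist_closed[OF twist(3,4)]] on_twist[OF twist(2-4)]
      by simp
  qed
  moreover have "f gs = 0 \<and> g gs = 0" if "gs \<notin> tuples (P_Sigma n) (Suc 0)" for gs
    using assms(1,2) that by (simp add: cocycles1_iff)
  ultimately have "f gs = g gs" for gs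
    by (cases "gs \<in> tuples (P_Sigma n) (Suc 0)") (auto simp: tuples_1)
  then show ?thesis by blast
qed

lemma dual_class_eq:
  assumes "p \<in> {1..n}" "q \<in> {1..n}" "p \<noteq> q"
  shows "dual_class n p q = {basis_cocycle n p q :: (word \<Rightarrow> word) list \<Rightarrow> 'k::field}"
  unfolding dual_class_def
proof (rule the_equality)
  show "{basis_cocycle n p q :: _ \<Rightarrow> 'k} \<in> carrier (group_cohomology (P_Sigma n) 1)
    \<and> (\<forall>f\<in>{basis_cocycle n p q}. \<forall>r\<in>{1..n}. \<forall>s\<in>{1..n}. r \<noteq> s \<longrightarrow>
          f [beta n r s] = (if r = p \<and> s = q then 1 else 0 :: 'k))"
    using basis_cocycle_closed[OF assms(1,3), where 'a = 'k] assms(1,3)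
    by (auto simp: carrier_H1 basis_cocycle_beta simp del: atLeastAtMost_iff)
  fix c :: "((word \<Rightarrow> word) list \<Rightarrow> 'k) set"
  assume c: "c \<in> carrier (group_cohomology (P_Sigma n) 1)
    \<and> (\<forall>f\<in>c. \<forall>r\<in>{1..n}. \<forall>s\<in>{1..n}. r \<noteq> s \<longrightarrow>
          f [beta n r s] = (if r = p \<and> s = q then 1 else 0))"
  then obtain f where f: "c = {f}" "f \<in> cocycles1 (P_Sigma n)"
    by (auto simp: carrier_H1)
  have "f = basis_cocycle n p q"
    using f(2) basis_cocycle_closed[OF assms(1,3)]
  proof (rule cocycles1_P_Sigma_eqI)
    fix r s assume "r \<in> {1..n}" "s \<in> {1..n}" "r \<noteq> s"
    then show "f [beta n r s] = basis_cocycle n p q [beta n r s]"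
      using c f(1) basis_cocycle_beta[OF _ _ _ assms(1,3), of r s] by auto
  qed
  then show "c = {basis_cocycle n p q}" using f(1) by simp
qed


section \<open>Relations between the basis classes\<close>

text \<open>By \<open>coord3_mult'\<close>, \<open>coord3 i j i\<close> fails to be additive by
  twice this product. The minus sign of the primitive comes from the convention h x + h y - h (x
  y).\<close>

lemma cup_exact_opposite:
  assumes "i \<in> {1..n}" "i \<noteq> j"
  shows "cup_exact (P_Sigma n) (\<lambda>\<phi> \<psi>. coord j i \<phi> * coord i j \<psi> :: 'k::field_char_0)"
  unfolding cup_exact_def
  by (intro exI[of _ "\<lambda>\<phi>. - (coord3 i j i \<phi> / 2)"])
    (simp add: coord3_mult'[OF _ _ assms] field_simps)

text \<open>Of the four terms of the expanded product, \<open>O\<close> is e_ji e_ij and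
  \<open>R\<close> supplies - e_ji e_kj + e_ki e_kj, but with e_ij e_ki in place of - e_ki e_ij;
  subtracting the symmetrized product \<open>S\<close> corrects this.\<close>

lemma cup_exact_triangle:
  assumes i: "i \<in> {1..n}" "j \<in> {1..n}" "k \<in> {1..n}" and d: "distinct [i, j, k]"
  shows "cup_exact (P_Sigma n)
    (\<lambda>\<phi> \<psi>. (coord j i \<phi> - coord k i \<phi>) * (coord i j \<psi> - coord k j \<psi>) :: 'k::field_char_0)"
proof -
  have R: "cup_exact (P_Sigma n) (\<lambda>\<phi> \<psi>. coord i j \<phi> * coord k i \<psi> - coord j i \<phi> * coord k j \<psi>
      + coord k i \<phi> * coord k j \<psi> :: 'k)"
    unfolding cup_exact_def
    using d coord3_mult[OF _ _ i(3), of _ _ i j, where 'k = 'k]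
    by (intro exI[of _ "\<lambda>\<phi>. - coord3 k i j \<phi>"]) auto
  have S: "cup_exact (P_Sigma n) (\<lambda>\<phi> \<psi>. coord i j \<phi> * coord k i \<psi> + coord k i \<phi> * coord i j \<psi> :: 'k)"
    using d i by (intro cup_exact_symmetrized coord_mult) auto
  have O: "cup_exact (P_Sigma n) (\<lambda>\<phi> \<psi>. coord j i \<phi> * coord i j \<psi> :: 'k)"
    using d i by (intro cup_exact_opposite) auto
  show ?thesis
    using cup_exact_lincomb[OF cup_exact_lincomb[OF O R, of 1 1] S, of 1 "-1"]
    by (rule cup_exact_cong) (simp add: algebra_simps)
qed

text \<open>The expression h x + h y - h (x y) is symmetric in x and y as soon as they
  commute.\<close>

lemma commuting_cup_exact:
  assumes "cup_exact G m" "x \<in> carrier G" "y \<in> carrier G" "x \<otimes>\<^bsub>G\<^esub> y = y \<otimes>\<^bsub>G\<^esub> x"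
  shows "m x y = m y x"
proof -
  obtain h where h: "\<And>x y. \<lbrakk>x \<in> carrier G; y \<in> carrier G\<rbrakk> \<Longrightarrow> m x y = h x + h y - h (x \<otimes>\<^bsub>G\<^esub> y)"
    using assms(1) unfolding cup_exact_def by blast
  show ?thesis using h[of x y] h[of y x] assms by (simp add: add.commute)
qed

section \<open>Commuting products of generators\<close>

lemma beta_gen:
  assumes "p \<in> {1..n}" "q \<in> {1..n}" "p \<noteq> q" "i \<in> {1..n}"
  shows "beta n p q (gen i) = conj_word i (if i = p then gen q else [])"
  using assms by (simp add: beta_eq_twist twist_gen) (simp add: gen_def)

text \<open>The left factor moves only x_p, so it fixes a conjugator that is empty or x_r with r
  \<noteq> p, and the conjugators are simply multiplied.\<close>

lemma beta_mult_gen: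
  assumes "p \<in> {1..n}" "q \<in> {1..n}" "p \<noteq> q" "i \<in> {1..n}" "r \<in> {1..n}" "r \<noteq> p"
    and "\<psi> \<in> carrier (P_Sigma n)" "\<psi> (gen i) = conj_word i w" "w = [] \<or> w = gen r"
  shows "(beta n p q \<otimes>\<^bsub>P_Sigma n\<^esub> \<psi>) (gen i)
    = conj_word i (foldr push (if i = p then gen q else []) w)"
proof -
  have \<beta>: "beta n p q \<in> carrier (P_Sigma n)" using assms(1-3) by (rule beta_closed)
  have nil: "[] \<in> carrier (free_group n)" by (simp add: carrier_free_group)
  have "beta n p q w = w"
    using assms(9) beta_gen[OF assms(1-3,5)] assms(6) hom_free_group_Nil[OF P_SigmaD(1)[OF \<beta>]] by auto
  moreover have "(if i = p then gen q else []) \<in> carrier (free_group n)"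
    using nil gen_closed[OF assms(2)] by simp
  moreover have "w \<in> carrier (free_group n)" using nil gen_closed[OF assms(5)] assms(9) by auto
  ultimately show ?thesis
    using mult_P_Sigma_gen[OF \<beta> assms(7,4) _ beta_gen[OF assms(1-4)] _ assms(8)] by simp
qed

text \<open>The case j = l is allowed, so this covers both the pairs with four distinct indices and
  the pairs with a common conjugating generator.\<close>

lemma beta_commute_disjoint:
  assumes "i \<in> {1..n}" "j \<in> {1..n}" "k \<in> {1..n}" "l \<in> {1..n}"
    and "i \<noteq> j" "k \<noteq> l" "i \<noteq> k" "i \<noteq> l" "k \<noteq> j"
  shows "beta n i j \<otimes>\<^bsub>P_Sigma n\<^esub> beta n k l = beta n k l \<otimes>\<^bsub>P_Sigma n\<^esub> beta n i j"
proof (rule P_Sigma_eqI)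
  have b: "beta n i j \<in> carrier (P_Sigma n)" "beta n k l \<in> carrier (P_Sigma n)"
    using assms by (auto intro: beta_closed)
  then show "beta n i j \<otimes>\<^bsub>P_Sigma n\<^esub> beta n k l \<in> carrier (P_Sigma n)"
    "beta n k l \<otimes>\<^bsub>P_Sigma n\<^esub> beta n i j \<in> carrier (P_Sigma n)"
    by (auto intro: mult_closed_P_Sigma)
  fix m assume m: "m \<in> {1..n}"
  show "(beta n i j \<otimes>\<^bsub>P_Sigma n\<^esub> beta n k l) (gen m) = (beta n k l \<otimes>\<^bsub>P_Sigma n\<^esub> beta n i j) (gen m)"
    using beta_mult_gen[OF assms(1,2,5) m assms(4) _ b(2) beta_gen[OF assms(3,4,6) m]]
      beta_mult_gen[OF assms(3,4,6) m assms(2) _ b(1) beta_gen[OF assms(1,2,5) m]] assms(7-9)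
    by (auto simp: gen_def)
qed

text \<open>\<gamma> conjugates both x_i and x_j by x_k. At x_i one order gives the conjugator x_j
  x_k, the other x_k \<gamma>(x_j) = x_k x_k^-1 x_j x_k, which is the same word.\<close>

lemma beta_commute_product:
  assumes i: "i \<in> {1..n}" "j \<in> {1..n}" "k \<in> {1..n}" and d: "i \<noteq> j" "i \<noteq> k" "j \<noteq> k"
  defines "\<gamma> \<equiv> beta n i k \<otimes>\<^bsub>P_Sigma n\<^esub> beta n j k"
  shows "beta n i j \<otimes>\<^bsub>P_Sigma n\<^esub> \<gamma> = \<gamma> \<otimes>\<^bsub>P_Sigma n\<^esub> beta n i j"
proof (rule P_Sigma_eqI)
  have b: "beta n i j \<in> carrier (P_Sigma n)" "beta n i k \<in> carrier (P_Sigma n)"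
    "beta n j k \<in> carrier (P_Sigma n)"
    using i d by (auto intro: beta_closed)
  have \<gamma>: "\<gamma> \<in> carrier (P_Sigma n)"
    unfolding \<gamma>_def using b by (auto intro: mult_closed_P_Sigma)
  then show "beta n i j \<otimes>\<^bsub>P_Sigma n\<^esub> \<gamma> \<in> carrier (P_Sigma n)"
    "\<gamma> \<otimes>\<^bsub>P_Sigma n\<^esub> beta n i j \<in> carrier (P_Sigma n)"
    using b by (auto intro: mult_closed_P_Sigma)
  have \<gamma>_gen: "\<gamma> (gen m) = conj_word m (if m = i \<or> m = j then gen k else [])" if "m \<in> {1..n}" for m
    using beta_mult_gen[OF i(1,3) d(2) that i(3) _ b(3) beta_gen[OF i(2,3) d(3) that]] d
    by (auto simp: \<gamma>_def gen_def)
  have nil: "[] \<in> carrier (free_group n)" by (simp add: carrier_free_group)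
  fix m assume m: "m \<in> {1..n}"
  have "(\<gamma> \<otimes>\<^bsub>P_Sigma n\<^esub> beta n i j) (gen m)
      = conj_word m (foldr push (if m = i \<or> m = j then gen k else []) (\<gamma> (if m = i then gen j else [])))"
    using nil gen_closed i by (intro mult_P_Sigma_gen[OF \<gamma> b(1) m _ \<gamma>_gen[OF m] _ beta_gen[OF i(1,2) d(1) m]]) auto
  moreover have "\<gamma> (gen j) = [(k, False), (j, True), (k, True)]"
    using \<gamma>_gen[OF i(2)] d by (simp add: conj_word_def gen_def word_inv_def inv_letter_def)
  moreover have "\<gamma> [] = []" using hom_free_group_Nil[OF P_SigmaD(1)[OF \<gamma>]] .
  moreover have "(beta n i j \<otimes>\<^bsub>P_Sigma n\<^esub> \<gamma>) (gen m)
      = conj_word m (foldr push (if m = i then gen j else []) (if m = i \<or> m = j then gen k else []))"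
    using d by (intro beta_mult_gen[OF i(1,2) d(1) m i(3) _ \<gamma> \<gamma>_gen[OF m]]) auto
  ultimately show "(beta n i j \<otimes>\<^bsub>P_Sigma n\<^esub> \<gamma>) (gen m) = (\<gamma> \<otimes>\<^bsub>P_Sigma n\<^esub> beta n i j) (gen m)"
    using d by (auto simp: gen_def inv_letter_def)
qed

section \<open>The resonance variety\<close>

lemma three_sorted:
  fixes k l m :: nat
  assumes "distinct [k, l, m]"
  obtains i j p where "i < j" "j < p" "{i, j, p} = {k, l, m}"
proof -
  consider "k < l" "l < m" | "k < m" "m < l" | "l < k" "k < m" | "l < m" "m < k" | "m < k" "k < l"
    | "m < l" "l < k"
    using assms by (auto simp: neq_iff)
  then show thesis
  proof cases
    case 1 then show ?thesis using that[of k l m] by simp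
  next
    case 2 then show ?thesis using that[of k m l] by (simp add: insert_commute)
  next
    case 3 then show ?thesis using that[of l k m] by (simp add: insert_commute)
  next
    case 4 then show ?thesis using that[of l m k] by (simp add: insert_commute)
  next
    case 5 then show ?thesis using that[of m k l] by (simp add: insert_commute)
  next
    case 6 then show ?thesis using that[of m l k] by (simp add: insert_commute)
  qed
qed

theorem theorem1:
  fixes n :: nat
    and H1 :: "('k :: {alg_closed_field, field_char_0}, ((word \<Rightarrow> word) list \<Rightarrow> 'k) set) module"
    and e :: "nat \<Rightarrow> nat \<Rightarrow> ((word \<Rightarrow> word) list \<Rightarrow> 'k) set"
  assumes "n \<ge> 2"
  defines "H1 \<equiv> group_cohomology (P_Sigma n) 1"
    and "e \<equiv> dual_class n"
  shows "first_resonance (cohomology_ring (P_Sigma n)) =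
      (\<Union>(i, j)\<in>{(i, j). 1 \<le> i \<and> i < j \<and> j \<le> n}.
         lin_span H1 {e i j, e j i})
    \<union> (\<Union>(i, j, k)\<in>{(i, j, k). 1 \<le> i \<and> i < j \<and> j < k \<and> k \<le> n}.
         lin_span H1 {e j i \<ominus>\<^bsub>H1\<^esub> e k i, e i j \<ominus>\<^bsub>H1\<^esub> e k j, e i k \<ominus>\<^bsub>H1\<^esub> e j k})"
proof -
  let ?G = "P_Sigma n"
  let ?E = "basis_cocycle n :: nat \<Rightarrow> nat \<Rightarrow> (word \<Rightarrow> word) list \<Rightarrow> 'k"
  let ?R = "first_resonance (cohomology_ring ?G) :: ((word \<Rightarrow> word) list \<Rightarrow> 'k) set set"
  \<comment> \<open>The first index is the common second index of both basis classes;
    \<open>?D\<close> changes sign when the other two are exchanged.\<close>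
  let ?D = "\<lambda>i j k gs. ?E j i gs - ?E k i gs"
  have E: "?E p q \<in> cocycles1 ?G" if "p \<in> {1..n}" "q \<in> {1..n}" "p \<noteq> q" for p q
    using that by (intro basis_cocycle_closed)
  have D: "?D i j k \<in> cocycles1 ?G" if "{i, j, k} \<subseteq> {1..n}" "distinct [i, j, k]" for i j k
    using that by (intro cocycles1_diff E) auto
  have span2: "lin_span H1 {e i j, e j i} = {{\<lambda>gs. a * ?E i j gs + b * ?E j i gs + c * ?E j i gs} | a b c. True}"
    if "1 \<le> i" "i < j" "j \<le> n" for i j
  proof -
    have "lin_span H1 {e i j, e j i} = lin_span (group_cohomology ?G (Suc 0)) {{?E i j}, {?E j i}, {?E j i}}"
      using that by (simp add: H1_def e_def dual_class_eq)
    then show ?thesis using lin_span_H1[OF E E E, of i j j i j i] that by simp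
  qed
  have span3: "lin_span H1 {e j i \<ominus>\<^bsub>H1\<^esub> e k i, e i j \<ominus>\<^bsub>H1\<^esub> e k j, e i k \<ominus>\<^bsub>H1\<^esub> e j k}
      = {{\<lambda>gs. a * ?D i j k gs + b * ?D j i k gs + c * ?D k i j gs} | a b c. True}"
    if "1 \<le> i" "i < j" "j < k" "k \<le> n" for i j k
  proof -
    have "e q p \<ominus>\<^bsub>H1\<^esub> e r p = {?D p q r}" if "{p, q, r} \<subseteq> {1..n}" "distinct [p, q, r]" for p q r
      using that minus_H1[OF E E, of q p r p] by (simp add: H1_def e_def dual_class_eq)
    from this[of i j k] this[of j i k] this[of k i j]
    have "lin_span H1 {e j i \<ominus>\<^bsub>H1\<^esub> e k i, e i j \<ominus>\<^bsub>H1\<^esub> e k j, e i k \<ominus>\<^bsub>H1\<^esub> e j k}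
        = lin_span (group_cohomology ?G (Suc 0)) {{?D i j k}, {?D j i k}, {?D k i j}}"
      using that by (simp add: H1_def)
    also have "\<dots> = {{\<lambda>gs. a * ?D i j k gs + b * ?D j i k gs + c * ?D k i j gs} | a b c. True}"
      using that by (intro lin_span_H1 D) auto
    finally show ?thesis .
  qed
  have in2: "{\<lambda>gs. a * ?E i j gs + b * ?E j i gs + c * ?E j i gs} \<in> ?R"
    if ij: "1 \<le> i" "i < j" "j \<le> n" for i j a b c
  proof (rule first_resonance_contains_isotropic[where gs = "[beta n i j]" and gs' = "[beta n j i]"])
    have "cup_exact ?G (\<lambda>\<phi> \<psi>. coord i j \<phi> * coord j i \<psi> :: 'k)"
      using ij by (intro cup_exact_opposite) auto
    then have "cup_exact ?G (\<lambda>x y. ?E i j [x] * ?E j i [y])"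
      by (rule cup_exact_cong) (simp add: basis_cocycle_apply)
    then show "cup_exact ?G (\<lambda>x y. ?E i j [x] * ?E j i [y])" "cup_exact ?G (\<lambda>x y. ?E i j [x] * ?E j i [y])"
      by blast+
    show "cup_exact ?G (\<lambda>x y. ?E j i [x] * ?E j i [y])"
      using E[of j i] ij by (intro cup_exact_self) (auto simp: cocycles1_iff)
    show "?E i j [beta n i j] = 1" "?E j i [beta n i j] = 0" "?E i j [beta n j i] = 0" "?E j i [beta n j i] = 1"
      using ij by (auto simp: basis_cocycle_beta)
  qed (use ij E mult_closed_P_Sigma in auto)
  have in3: "{\<lambda>gs. a * ?D i j k gs + b * ?D j i k gs + c * ?D k i j gs} \<in> ?R"
    if "1 \<le> i" "i < j" "j < k" "k \<le> n" for i j k a b c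
  proof (rule first_resonance_contains_isotropic[where gs = "[beta n j i]" and gs' = "[beta n i j]"])
    have ijk: "{i, j, k} \<subseteq> {1..n}" "distinct [i, j, k]" using that by auto
    have T: "cup_exact ?G (\<lambda>x y. ?D p q r [x] * ?D q p r [y])"
      if "{p, q, r} \<subseteq> {1..n}" "distinct [p, q, r]" for p q r
    proof (rule cup_exact_cong)
      show "cup_exact ?G (\<lambda>x y. (coord q p x - coord r p x) * (coord p q y - coord r q y) :: 'k)"
        using that by (intro cup_exact_triangle) auto
    qed (simp add: basis_cocycle_apply)
    show "cup_exact ?G (\<lambda>x y. ?D i j k [x] * ?D j i k [y])"
      by (rule T[OF ijk])
    \<comment> \<open>The triangle relation for i, k, j contains \<open>?D i k j\<close>, which is
      the negative of \<open>?D i j k\<close>; the factor -1 repairs this. For j, k, i below, both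
      factors change sign.\<close>
    have "cup_exact ?G (\<lambda>x y. ?D i k j [x] * ?D k i j [y])"
      by (rule T) (use ijk in auto)
    from cup_exact_lincomb[OF this this, of "-1" 0]
    show "cup_exact ?G (\<lambda>x y. ?D i j k [x] * ?D k i j [y])"
      by (rule cup_exact_cong) (simp add: algebra_simps)
    have "cup_exact ?G (\<lambda>x y. ?D j k i [x] * ?D k j i [y])"
      by (rule T) (use ijk in auto)
    then show "cup_exact ?G (\<lambda>x y. ?D j i k [x] * ?D k i j [y])"
      by (rule cup_exact_cong) (simp add: algebra_simps)
    show "?D i j k [beta n j i] = 1" "?D j i k [beta n j i] = 0" "?D i j k [beta n i j] = 0"
      "?D j i k [beta n i j] = 1"
      using ijk by (auto simp: basis_cocycle_beta)
  qed (use that D mult_closed_P_Sigma in auto)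
  have sub: "(\<exists>i j a b c. 1 \<le> i \<and> i < j \<and> j \<le> n \<and> f = (\<lambda>gs. a * ?E i j gs + b * ?E j i gs + c * ?E j i gs))
      \<or> (\<exists>i j k a b c. 1 \<le> i \<and> i < j \<and> j < k \<and> k \<le> n
          \<and> f = (\<lambda>gs. a * ?D i j k gs + b * ?D j i k gs + c * ?D k i j gs))"
    if f: "f \<in> cocycles1 ?G" and g: "g \<in> cocycles1 ?G"
      and exact: "cup_exact ?G (\<lambda>x y. f [x] * g [y])" and ne: "\<forall>c. g \<noteq> (\<lambda>gs. c * f gs)"
    for f g :: "(word \<Rightarrow> word) list \<Rightarrow> 'k"
  proof -
    define a where "a p q = f [beta n p q]" for p q
    define b where "b p q = g [beta n p q]" for p q
    have add: "f [x \<otimes>\<^bsub>?G\<^esub> y] = f [x] + f [y]" "g [x \<otimes>\<^bsub>?G\<^esub> y] = g [x] + g [y]"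
      if "x \<in> carrier ?G" "y \<in> carrier ?G" for x y
      using f g that by (auto simp: cocycles1_iff)
    have two: "\<exists>i j a b c. 1 \<le> i \<and> i < j \<and> j \<le> n \<and> f = (\<lambda>gs. a * ?E i j gs + b * ?E j i gs + c * ?E j i gs)"
      if kl: "k \<in> {1..n}" "l \<in> {1..n}" "k \<noteq> l"
        and 0: "\<And>p q. \<lbrakk>p \<in> {1..n}; q \<in> {1..n}; p \<noteq> q; {p, q} \<noteq> {k, l}\<rbrakk> \<Longrightarrow> a p q = 0" for k l
    proof -
      obtain i j where ij: "i < j" "{i, j} = {k, l}"
        using kl(3) by (metis insert_commute linorder_neqE_nat)
      have ijn: "i \<in> {1..n}" "j \<in> {1..n}" using ij(2) kl(1,2) by (auto simp: doubleton_eq_iff)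
      have "f = (\<lambda>gs. a i j * ?E i j gs + a j i * ?E j i gs)"
        using f
      proof (rule cocycles1_P_Sigma_eqI)
        show "(\<lambda>gs. a i j * ?E i j gs + a j i * ?E j i gs) \<in> cocycles1 ?G"
          using ij(1) ijn by (intro cocycles1_lincomb E) auto
        fix r s assume rs: "r \<in> {1..n}" "s \<in> {1..n}" "r \<noteq> s"
        have "a r s = 0" if "\<not> (r = i \<and> s = j)" "\<not> (r = j \<and> s = i)"
          using 0[OF rs] that unfolding ij(2)[symmetric] by (auto simp: doubleton_eq_iff)
        then show "f [beta n r s] = a i j * ?E i j [beta n r s] + a j i * ?E j i [beta n r s]"
          using rs ijn ij(1) by (auto simp: basis_cocycle_beta a_def[symmetric] simp del: atLeastAtMost_iff)
      qed
      then have "f = (\<lambda>gs. a i j * ?E i j gs + a j i * ?E j i gs + 0 * ?E j i gs)" by simp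
      then show ?thesis using ij(1) ijn by (metis atLeastAtMost_iff)
    qed
    have three: "\<exists>i j k a b c. 1 \<le> i \<and> i < j \<and> j < k \<and> k \<le> n
          \<and> f = (\<lambda>gs. a * ?D i j k gs + b * ?D j i k gs + c * ?D k i j gs)"
      if klm: "k \<in> {1..n}" "l \<in> {1..n}" "m \<in> {1..n}" "distinct [k, l, m]"
        and eq: "a l k = - a m k" "a k l = - a m l" "a k m = - a l m"
        and 0: "\<And>p q. \<lbrakk>p \<in> {1..n}; q \<in> {1..n}; p \<noteq> q; \<not> {p, q} \<subseteq> {k, l, m}\<rbrakk> \<Longrightarrow> a p q = 0"
      for k l m
    proof -
      obtain i j p where ijp: "i < j" "j < p" "{i, j, p} = {k, l, m}"
        using three_sorted[OF klm(4)] by metis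
      have "{i, j, p} \<subseteq> {1..n}" unfolding ijp(3) using klm(1-3) by blast
      then have n: "i \<in> {1..n}" "j \<in> {1..n}" "p \<in> {1..n}" by blast+
      \<comment> \<open>The three equations say that values with a common second index are opposite.
        This is symmetric in k, l, m, so it survives the sorting of the indices.\<close>
      have anti: "a x z = - a y z" if "distinct [x, y, z]" "{x, y, z} = {k, l, m}" for x y z
      proof -
        have "x \<in> {k, l, m}" "y \<in> {k, l, m}" "z \<in> {k, l, m}" unfolding that(2)[symmetric] by auto
        then show ?thesis using that(1) eq by auto
      qed
      have eq': "a p i = - a j i" "a p j = - a i j" "a j p = - a i p"
        by (rule anti; use ijp in auto)+
      have feq: "f = (\<lambda>gs. a j i * ?D i j p gs + a i j * ?D j i p gs + a i p * ?D p i j gs)"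
        using f
      proof (rule cocycles1_P_Sigma_eqI)
        have "?D i j p \<in> cocycles1 ?G" "?D j i p \<in> cocycles1 ?G" "?D p i j \<in> cocycles1 ?G"
          using ijp(1,2) n by (auto intro!: D)
        from cocycles1_lincomb[OF cocycles1_lincomb[OF this(1,2)] this(3), of 1]
        show "(\<lambda>gs. a j i * ?D i j p gs + a i j * ?D j i p gs + a i p * ?D p i j gs) \<in> cocycles1 ?G"
          by simp
        fix r s assume rs: "r \<in> {1..n}" "s \<in> {1..n}" "r \<noteq> s"
        have rs0: "a r s = 0" if "\<not> (r \<in> {i, j, p} \<and> s \<in> {i, j, p})"
          using 0[OF rs] that unfolding ijp(3)[symmetric] by auto
        show "f [beta n r s] = a j i * ?D i j p [beta n r s] + a i j * ?D j i p [beta n r s]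
            + a i p * ?D p i j [beta n r s]"
        proof (cases "r \<in> {i, j, p} \<and> s \<in> {i, j, p}")
          case True
          then show ?thesis
            using rs n ijp(1,2) eq'
            by (auto simp: basis_cocycle_beta a_def[symmetric] simp del: atLeastAtMost_iff)
        next
          case False
          then show ?thesis
            using rs n ijp(1,2) rs0[OF False]
            by (auto simp: basis_cocycle_beta a_def[symmetric] simp del: atLeastAtMost_iff)
        qed
      qed
      show ?thesis
        by (intro exI[of _ i] exI[of _ j] exI[of _ p] exI[of _ "a j i"] exI[of _ "a i j"]
            exI[of _ "a i p"] conjI feq) (use ijp(1,2) n in simp_all)
    qed
    show ?thesis
    proof (cases "f = (\<lambda>gs. 0)")
      case True
      \<comment> \<open>The zero class lies in the span for the pair 1, 2, which exists as n \<ge>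
        2.\<close>
      then show ?thesis using two[of 1 2] assms(1) by (auto simp: a_def)
    next
      case False
      obtain r s where rs: "r \<in> {1..n}" "s \<in> {1..n}" "r \<noteq> s" "a r s \<noteq> 0"
        using cocycles1_P_Sigma_eqI[OF f cocycles1_zero] False unfolding a_def by blast
      \<comment> \<open>This multiple of f agrees with g at beta_rs. As g is not a multiple of f and
        homomorphisms are determined on the generators, they differ at some beta_pq, which gives a
        nonzero minor.\<close>
      define c where "c = b r s / a r s"
      have "(\<lambda>gs. c * f gs) \<in> cocycles1 ?G"
        using cocycles1_lincomb[OF f f, of c 0] by simp
      then obtain p q where pq: "p \<in> {1..n}" "q \<in> {1..n}" "p \<noteq> q" "b p q \<noteq> c * a p q"
        using cocycles1_P_Sigma_eqI[OF g] ne unfolding a_def b_def by blast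
      have indep: "a r s * b p q \<noteq> a p q * b r s"
        using pq(4) rs(4) by (simp add: c_def field_simps)
      have comm: "f [x] * g [y] = f [y] * g [x]"
        if "x \<in> carrier ?G" "y \<in> carrier ?G" "x \<otimes>\<^bsub>?G\<^esub> y = y \<otimes>\<^bsub>?G\<^esub> x" for x y
        using commuting_cup_exact[OF exact that] .
      have disjoint: "a i j * b k l = a k l * b i j"
        if "i \<in> {1..n}" "j \<in> {1..n}" "k \<in> {1..n}" "l \<in> {1..n}" "distinct [i, j, k, l]" for i j k l
        unfolding a_def b_def using that
        by (intro comm beta_closed beta_commute_disjoint) auto
      have target: "a i k * b j k = a j k * b i k"
        if "i \<in> {1..n}" "j \<in> {1..n}" "k \<in> {1..n}" "distinct [i, j, k]" for i j k
        unfolding a_def b_def using that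
        by (intro comm beta_closed beta_commute_disjoint) auto
      have triple: "a i j * (b i k + b j k) = (a i k + a j k) * b i j"
        if ijk: "i \<in> {1..n}" "j \<in> {1..n}" "k \<in> {1..n}" "distinct [i, j, k]" for i j k
      proof -
        have \<beta>: "beta n i j \<in> carrier ?G" "beta n i k \<in> carrier ?G" "beta n j k \<in> carrier ?G"
          using ijk by (auto intro!: beta_closed)
        have "f [beta n i j] * g [beta n i k \<otimes>\<^bsub>?G\<^esub> beta n j k] = f [beta n i k \<otimes>\<^bsub>?G\<^esub> beta n j k] * g [beta n i j]"
          using ijk \<beta> by (intro comm mult_closed_P_Sigma beta_commute_product) auto
        then show ?thesis using \<beta> by (simp add: add a_def b_def)
      qed
      show ?thesis
      proof (rule coefficients_of_isotropic_pair[of "{1..n}" a b r s p q])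
        fix k l
        assume *: "k \<in> {1..n}" "l \<in> {1..n}" "k \<noteq> l"
          "\<And>p q. \<lbrakk>p \<in> {1..n}; q \<in> {1..n}; p \<noteq> q; {p, q} \<noteq> {k, l}\<rbrakk> \<Longrightarrow> a p q = 0"
        show ?thesis by (rule disjI1, rule two[OF *(1-3)], rule *(4))
      next
        fix k l m
        assume *: "k \<in> {1..n}" "l \<in> {1..n}" "m \<in> {1..n}" "distinct [k, l, m]"
          "a l k = - a m k" "a k l = - a m l" "a k m = - a l m"
          "\<And>p q. \<lbrakk>p \<in> {1..n}; q \<in> {1..n}; p \<noteq> q; \<not> {p, q} \<subseteq> {k, l, m}\<rbrakk> \<Longrightarrow> a p q = 0"
        show ?thesis by (rule disjI2, rule three[OF *(1-7)], rule *(8))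
      qed (fact disjoint target triple rs pq indep)+
    qed
  qed
  show ?thesis
  proof (intro equalityI subsetI)
    fix X assume "X \<in> ?R"
    then have "\<exists>f. X = {f} \<and> f \<in> cocycles1 ?G \<and> (\<exists>g\<in>cocycles1 ?G. cup_exact ?G (\<lambda>x y. f [x] * g [y])
        \<and> (\<forall>c. g \<noteq> (\<lambda>gs. c * f gs)))"
      by (simp only: first_resonance_cohomology_ring[OF mult_closed_P_Sigma] mem_Collect_eq)
    then obtain f g where X: "X = {f}" and fg: "f \<in> cocycles1 ?G" "g \<in> cocycles1 ?G"
      "cup_exact ?G (\<lambda>x y. f [x] * g [y])" "\<forall>c. g \<noteq> (\<lambda>gs. c * f gs)"
      by (elim exE conjE bexE)
    from sub[OF fg] show "X \<in> (\<Union>(i, j)\<in>{(i, j). 1 \<le> i \<and> i < j \<and> j \<le> n}. lin_span H1 {e i j, e j i})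
        \<union> (\<Union>(i, j, k)\<in>{(i, j, k). 1 \<le> i \<and> i < j \<and> j < k \<and> k \<le> n}.
          lin_span H1 {e j i \<ominus>\<^bsub>H1\<^esub> e k i, e i j \<ominus>\<^bsub>H1\<^esub> e k j, e i k \<ominus>\<^bsub>H1\<^esub> e j k})"
    proof (elim disjE exE conjE)
      fix i j a b c
      assume ij: "1 \<le> i" "i < j" "j \<le> n" and f: "f = (\<lambda>gs. a * ?E i j gs + b * ?E j i gs + c * ?E j i gs)"
      have "X \<in> lin_span H1 {e i j, e j i}"
        unfolding X span2[OF ij] by (rule CollectI, intro exI conjI TrueI, unfold f, rule refl)
      then show ?thesis using ij by blast
    next
      fix i j k a b c
      assume ijk: "1 \<le> i" "i < j" "j < k" "k \<le> n"
        and f: "f = (\<lambda>gs. a * ?D i j k gs + b * ?D j i k gs + c * ?D k i j gs)"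
      have "X \<in> lin_span H1 {e j i \<ominus>\<^bsub>H1\<^esub> e k i, e i j \<ominus>\<^bsub>H1\<^esub> e k j, e i k \<ominus>\<^bsub>H1\<^esub> e j k}"
        unfolding X span3[OF ijk] by (rule CollectI, intro exI conjI TrueI, unfold f, rule refl)
      then show ?thesis using ijk by blast
    qed
  next
    fix X
    assume "X \<in> (\<Union>(i, j)\<in>{(i, j). 1 \<le> i \<and> i < j \<and> j \<le> n}. lin_span H1 {e i j, e j i})
        \<union> (\<Union>(i, j, k)\<in>{(i, j, k). 1 \<le> i \<and> i < j \<and> j < k \<and> k \<le> n}.
          lin_span H1 {e j i \<ominus>\<^bsub>H1\<^esub> e k i, e i j \<ominus>\<^bsub>H1\<^esub> e k j, e i k \<ominus>\<^bsub>H1\<^esub> e j k})"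
    then consider i j where "1 \<le> i" "i < j" "j \<le> n" "X \<in> lin_span H1 {e i j, e j i}"
      | i j k where "1 \<le> i" "i < j" "j < k" "k \<le> n"
        "X \<in> lin_span H1 {e j i \<ominus>\<^bsub>H1\<^esub> e k i, e i j \<ominus>\<^bsub>H1\<^esub> e k j, e i k \<ominus>\<^bsub>H1\<^esub> e j k}"
      by blast
    then show "X \<in> ?R"
    proof cases
      case 1
      then obtain a b c where "X = {\<lambda>gs. a * ?E i j gs + b * ?E j i gs + c * ?E j i gs}"
        by (auto simp: span2)
      then show ?thesis using in2[OF 1(1-3)] by simp
    next
      case 2
      then obtain a b c where "X = {\<lambda>gs. a * ?D i j k gs + b * ?D j i k gs + c * ?D k i j gs}"
        by (auto simp: span3)
      then show ?thesis using in3[OF 2(1-4)] by simp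
    qed
  qed
qed

end
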